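(* Let $T$ be a lush hedge of height $H\ge2$ and let $A\in\mathcal R(T)$ have a critical multiplicity list, witnessed by distinct reals $\alpha_1,\alpha_2,\beta_2,\beta_3,\beta_4$. Then $A\in\mathcal{PH}(C^{\Lambda}_{H+1},T)$ for some $\Lambda\in\mathcal B$, and $$\sigma(A)=\bigcup_{i=1}^{H+1}\ell_i(T)\,\sigma(C^{\Lambda}_i),$$ so the whole spectrum of $A$ is determined by $\Lambda$ (and $T$). Moreover $\mathrm{mult}(\alpha_j,A)=\sum_{i\ge j,\ i\equiv j\ (\mathrm{mod}\ 2)}\ell_i(T)$ for $j=1,2$. In particular all of this applies to $A\in\mathcal S(T)$.
   Context: Hedges: a rooted tree has a distinguished root; $y$ is a child of adjacent $z$ if the root-to-$y$ path passes through $z$; a leaf is a non-root vertex of degree 1 (in $P_1$ the single vertex is root and leaf). A hedge is a rooted tree that is $P_1$ or in which all leaves are at equal distance from the root. $\mathrm h(u)$ is the distance from $u$ to a nearest leaf; the height of the hedge is that of its root; $V_i(T)$ is the set of vertices of height $i$; $\ell_i(T)=|V_{i-1}(T)|-|V_i(T)|$ for $i\ge1$. A hedge is lush if every vertex of height $\ge2$ has at least three children and every vertex of height $1$ at least two. $P_n$ is the path $1-\cdots-n$ rooted at $1$. $\mathcal R(T)$: real matrices indexed by $V(T)$ with $a_{ij}\neq0$ iff $\{i,j\}\in E(T)$ ($i\ne j$), $a_{ij}a_{ji}>0$ on edges, arbitrary diagonal; $\mathcal S(T)$ its symmetric members. Multiset union adds multiplicities; $s\Lambda$ multiplies multiplicities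 by $s$. Path-to-hedge: for $C=(c_{ij})\in\mathcal R(P_{H+1})$ and $v\in V(T)$ put $v'=H+1-\mathrm h(v)$; $\mathcal{PH}(C,T)$ is the set of $A\in\mathcal R(T)$ with $a_{vv}=c_{v'v'}$ for all $v$ and $\sum_{u\text{ child of }v}a_{vu}a_{uv}=c_{v',v'+1}c_{v'+1,v'}$ for every non-leaf $v$. $\mathcal B$ is the set of $(\alpha_1,\alpha_2,\beta_2,\beta_3,\beta_4)\in\mathbb R^5$ with distinct entries satisfying one of: $\beta_2<\alpha_1<\alpha_2<\beta_3<\beta_4$; $\beta_2<\beta_4<\alpha_1<\alpha_2<\beta_3$; $\beta_4<\beta_2<\alpha_1<\alpha_2<\beta_3$ and $\alpha_2+\beta_2>\beta_4+\beta_3$; $\beta_3<\beta_2<\alpha_1<\alpha_2<\beta_4$ and $\alpha_2+\beta_2<\beta_4+\beta_3$; $\beta_3<\beta_2<\beta_4<\alpha_1<\alpha_2$; $\beta_4<\beta_3<\beta_2<\alpha_1<\alpha_2$; $\beta_4<\beta_3<\alpha_2<\alpha_1<\beta_2$; $\beta_3<\alpha_2<\alpha_1<\beta_4<\beta_2$; $\beta_3<\alpha_2<\alpha_1<\beta_2<\beta_4$ and $\alpha_2+\beta_2<\beta_4+\beta_3$; $\beta_4<\alpha_2<\alpha_1<\beta_2<\beta_3$ and $\alpha_2+\beta_2>\beta_4+\beta_3$; $\alpha_2<\alpha_1<\beta_4<\beta_2<\beta_3$; $\alpha_2<\alpha_1<\beta_2<\beta_3<\beta_4$. For $\Lambda\in\mathcal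 B$, $C^{\Lambda}_n$ is the $n\times n$ tridiagonal matrix with diagonal $(a_n,\dots,a_1)$, superdiagonal $(b_n,\dots,b_2)$, subdiagonal all $1$, where $a_i=\alpha_1$ ($i$ odd), $a_2=-\alpha_1+\alpha_2+\beta_2$, $a_i=\alpha_2$ ($i>2$ even), $b_2=(\beta_2-\alpha_1)(\alpha_1-\alpha_2)$, $b_3=(\beta_3-\alpha_2)(\beta_3-\beta_2)$, $b_4=\frac{(\beta_4-\alpha_1)(\beta_3-\beta_4)(\alpha_2+\beta_2-\beta_3-\beta_4)}{\beta_4-\beta_2}$, $b_i=(\beta_j-\alpha_1)(\beta_j-\alpha_2)$ for $i>4$, $j\in\{2,3,4\}$, $i\equiv j\pmod 3$. Note $C^\Lambda_i$ is the trailing $i\times i$ principal submatrix of $C^\Lambda_{n}$ for $i\le n$. Critical multiplicity list: $A\in\mathcal R(T)$ has one if there exist five distinct reals $\alpha_1,\alpha_2,\beta_2,\beta_3,\beta_4$ (witnesses) with $\mathrm{mult}(\alpha_j,A)\ge\sum_{i\ge j,\ i\equiv j\ (2)}\ell_i(T)$ ($j=1,2$), $\mathrm{mult}(\beta_j,A)\ge\sum_{i\ge j,\ i\equiv j\ (3)}\ell_i(T)$ ($j=2,3,4$), and $\mathrm{mult}(\beta_4,A)<\ell_3(T)$ (multiplicity $0$ allowed). *)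

theory Defs
  imports "Jordan_Normal_Form.Char_Poly"
begin

text \<open>A rooted tree with n vertices, labelled 0..<n, is given by its root r and a
parent map par: every non-root vertex v has its parent par v (the neighbour of v on
the path from v to the root). The edges are exactly the pairs {v, par v}, v not the root.
The value par r is irrelevant.\<close>

definition rooted_tree :: "nat \<Rightarrow> nat \<Rightarrow> (nat \<Rightarrow> nat) \<Rightarrow> bool" where
  "rooted_tree n r par \<longleftrightarrow> r < n \<and>
     (\<forall>v<n. v \<noteq> r \<longrightarrow> par v < n) \<and>
     (\<forall>v<n. \<exists>k. (par ^^ k) v = r)"

definition adj :: "nat \<Rightarrow> nat \<Rightarrow> (nat \<Rightarrow> nat) \<Rightarrow> nat \<Rightarrow> nat \<Rightarrow> bool" where
  "adj n r par u v \<longleftrightarrow> u < n \<and> v < n \<and>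
     ((u \<noteq> r \<and> par u = v) \<or> (v \<noteq> r \<and> par v = u))"

definition is_child :: "nat \<Rightarrow> nat \<Rightarrow> (nat \<Rightarrow> nat) \<Rightarrow> nat \<Rightarrow> nat \<Rightarrow> bool" where
  "is_child n r par y z \<longleftrightarrow> y < n \<and> z < n \<and> y \<noteq> r \<and> par y = z"

definition children :: "nat \<Rightarrow> nat \<Rightarrow> (nat \<Rightarrow> nat) \<Rightarrow> nat \<Rightarrow> nat set" where
  "children n r par z = {y. is_child n r par y z}"

definition degree :: "nat \<Rightarrow> nat \<Rightarrow> (nat \<Rightarrow> nat) \<Rightarrow> nat \<Rightarrow> nat" where
  "degree n r par v = card {w. adj n r par v w}"

definition is_leaf :: "nat \<Rightarrow> nat \<Rightarrow> (nat \<Rightarrow> nat) \<Rightarrow> nat \<Rightarrow> bool" where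
  "is_leaf n r par v \<longleftrightarrow> v < n \<and>
     ((v \<noteq> r \<and> degree n r par v = 1) \<or> (n = 1 \<and> v = r))"

inductive walk :: "nat \<Rightarrow> nat \<Rightarrow> (nat \<Rightarrow> nat) \<Rightarrow> nat \<Rightarrow> nat \<Rightarrow> nat \<Rightarrow> bool"
  for n r par where
  walk0: "u < n \<Longrightarrow> walk n r par u u 0"
| walkS: "adj n r par u w \<Longrightarrow> walk n r par w v k \<Longrightarrow> walk n r par u v (Suc k)"

definition dist :: "nat \<Rightarrow> nat \<Rightarrow> (nat \<Rightarrow> nat) \<Rightarrow> nat \<Rightarrow> nat \<Rightarrow> nat" where
  "dist n r par u v = (LEAST k. walk n r par u v k)"

definition hgt :: "nat \<Rightarrow> nat \<Rightarrow> (nat \<Rightarrow> nat) \<Rightarrow> nat \<Rightarrow> nat" where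
  "hgt n r par u = (LEAST k. \<exists>l. is_leaf n r par l \<and> dist n r par u l = k)"

definition is_hedge :: "nat \<Rightarrow> nat \<Rightarrow> (nat \<Rightarrow> nat) \<Rightarrow> bool" where
  "is_hedge n r par \<longleftrightarrow> rooted_tree n r par \<and>
     (n = 1 \<or> (\<forall>l1 l2. is_leaf n r par l1 \<longrightarrow> is_leaf n r par l2 \<longrightarrow>
                 dist n r par r l1 = dist n r par r l2))"

definition hedge_height :: "nat \<Rightarrow> nat \<Rightarrow> (nat \<Rightarrow> nat) \<Rightarrow> nat" where
  "hedge_height n r par = hgt n r par r"

definition Vlev :: "nat \<Rightarrow> nat \<Rightarrow> (nat \<Rightarrow> nat) \<Rightarrow> nat \<Rightarrow> nat set" where
  "Vlev n r par i = {v. v < n \<and> hgt n r par v = i}"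

text \<open>ell_i(T) = |V_{i-1}(T)| - |V_i(T)| for i >= 1 (nonnegative for hedges, so
  natural-number subtraction is harmless)\<close>
definition ell :: "nat \<Rightarrow> nat \<Rightarrow> (nat \<Rightarrow> nat) \<Rightarrow> nat \<Rightarrow> nat" where
  "ell n r par i = card (Vlev n r par (i - 1)) - card (Vlev n r par i)"

definition lush :: "nat \<Rightarrow> nat \<Rightarrow> (nat \<Rightarrow> nat) \<Rightarrow> bool" where
  "lush n r par \<longleftrightarrow> is_hedge n r par \<and>
     (\<forall>v<n. hgt n r par v \<ge> 2 \<longrightarrow> card (children n r par v) \<ge> 3) \<and>
     (\<forall>v<n. hgt n r par v = 1 \<longrightarrow> card (children n r par v) \<ge> 2)"

definition in_R :: "nat \<Rightarrow> nat \<Rightarrow> (nat \<Rightarrow> nat) \<Rightarrow> real mat \<Rightarrow> bool" where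
  "in_R n r par A \<longleftrightarrow> A \<in> carrier_mat n n \<and>
     (\<forall>i<n. \<forall>j<n. i \<noteq> j \<longrightarrow> (A $$ (i,j) \<noteq> 0 \<longleftrightarrow> adj n r par i j)) \<and>
     (\<forall>i<n. \<forall>j<n. adj n r par i j \<longrightarrow> A $$ (i,j) * A $$ (j,i) > 0)"

definition in_S :: "nat \<Rightarrow> nat \<Rightarrow> (nat \<Rightarrow> nat) \<Rightarrow> real mat \<Rightarrow> bool" where
  "in_S n r par A \<longleftrightarrow> in_R n r par A \<and> A\<^sup>T = A"

text \<open>The path P_m = 1 - ... - m rooted at 1, here with vertices 0..<m rooted at 0,
  parent of vertex v being v - 1.\<close>
definition path_par :: "nat \<Rightarrow> nat" where "path_par v = v - 1"

definition spec :: "real mat \<Rightarrow> complex multiset" where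
  "spec A = proots (char_poly (map_mat complex_of_real A))"

definition mult :: "real \<Rightarrow> real mat \<Rightarrow> nat" where
  "mult x A = count (spec A) (complex_of_real x)"

text \<open>Indices of C are 0-based: the paper's c_{v'v'} with v' = H+1-h(v) is
  C $$ (H - h v, H - h v).\<close>
definition in_PH :: "real mat \<Rightarrow> nat \<Rightarrow> nat \<Rightarrow> (nat \<Rightarrow> nat) \<Rightarrow> real mat \<Rightarrow> bool" where
  "in_PH C n r par A \<longleftrightarrow>
     (let H = hedge_height n r par in
      in_R (H + 1) 0 path_par C \<and> in_R n r par A \<and>
      (\<forall>v<n. A $$ (v,v) = C $$ (H - hgt n r par v, H - hgt n r par v)) \<and>
      (\<forall>v<n. \<not> is_leaf n r par v \<longrightarrow>
         (\<Sum>u\<in>children n r par v. A $$ (v,u) * A $$ (u,v)) =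
         C $$ (H - hgt n r par v, H - hgt n r par v + 1) *
         C $$ (H - hgt n r par v + 1, H - hgt n r par v)))"

definition in_B :: "real \<times> real \<times> real \<times> real \<times> real \<Rightarrow> bool" where
  "in_B L = (case L of (a1, a2, b2, b3, b4) \<Rightarrow>
     distinct [a1, a2, b2, b3, b4] \<and>
     ( (b2 < a1 \<and> a1 < a2 \<and> a2 < b3 \<and> b3 < b4)
     \<or> (b2 < b4 \<and> b4 < a1 \<and> a1 < a2 \<and> a2 < b3)
     \<or> (b4 < b2 \<and> b2 < a1 \<and> a1 < a2 \<and> a2 < b3 \<and> a2 + b2 > b4 + b3)
     \<or> (b3 < b2 \<and> b2 < a1 \<and> a1 < a2 \<and> a2 < b4 \<and> a2 + b2 < b4 + b3)
     \<or> (b3 < b2 \<and> b2 < b4 \<and> b4 < a1 \<and> a1 < a2)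
     \<or> (b4 < b3 \<and> b3 < b2 \<and> b2 < a1 \<and> a1 < a2)
     \<or> (b4 < b3 \<and> b3 < a2 \<and> a2 < a1 \<and> a1 < b2)
     \<or> (b3 < a2 \<and> a2 < a1 \<and> a1 < b4 \<and> b4 < b2)
     \<or> (b3 < a2 \<and> a2 < a1 \<and> a1 < b2 \<and> b2 < b4 \<and> a2 + b2 < b4 + b3)
     \<or> (b4 < a2 \<and> a2 < a1 \<and> a1 < b2 \<and> b2 < b3 \<and> a2 + b2 > b4 + b3)
     \<or> (a2 < a1 \<and> a1 < b4 \<and> b4 < b2 \<and> b2 < b3)
     \<or> (a2 < a1 \<and> a1 < b2 \<and> b2 < b3 \<and> b3 < b4)))"

definition coef_a :: "real \<times> real \<times> real \<times> real \<times> real \<Rightarrow> nat \<Rightarrow> real" where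
  "coef_a L i = (case L of (a1, a2, b2, b3, b4) \<Rightarrow>
     if odd i then a1 else if i = 2 then - a1 + a2 + b2 else a2)"

definition coef_b :: "real \<times> real \<times> real \<times> real \<times> real \<Rightarrow> nat \<Rightarrow> real" where
  "coef_b L i = (case L of (a1, a2, b2, b3, b4) \<Rightarrow>
     if i = 2 then (b2 - a1) * (a1 - a2)
     else if i = 3 then (b3 - a2) * (b3 - b2)
     else if i = 4 then (b4 - a1) * (b3 - b4) * (a2 + b2 - b3 - b4) / (b4 - b2)
     else if i mod 3 = 2 then (b2 - a1) * (b2 - a2)
     else if i mod 3 = 0 then (b3 - a1) * (b3 - a2)
     else (b4 - a1) * (b4 - a2))"

definition CL :: "real \<times> real \<times> real \<times> real \<times> real \<Rightarrow> nat \<Rightarrow> real mat" where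
  "CL L m = mat m m (\<lambda>(i, j).
     if i = j then coef_a L (m - i)
     else if j = i + 1 then coef_b L (m - i)
     else if i = j + 1 then 1 else 0)"

definition crit_witness :: "nat \<Rightarrow> nat \<Rightarrow> (nat \<Rightarrow> nat) \<Rightarrow> real mat \<Rightarrow>
    real \<Rightarrow> real \<Rightarrow> real \<Rightarrow> real \<Rightarrow> real \<Rightarrow> bool" where
  "crit_witness n r par A a1 a2 b2 b3 b4 \<longleftrightarrow>
     (let H = hedge_height n r par; l = ell n r par in
      distinct [a1, a2, b2, b3, b4] \<and>
      mult a1 A \<ge> (\<Sum>i\<in>{i. 1 \<le> i \<and> i \<le> H + 1 \<and> i mod 2 = 1 mod 2}. l i) \<and>
      mult a2 A \<ge> (\<Sum>i\<in>{i. 2 \<le> i \<and> i \<le> H + 1 \<and> i mod 2 = 2 mod 2}. l i) \<and>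
      mult b2 A \<ge> (\<Sum>i\<in>{i. 2 \<le> i \<and> i \<le> H + 1 \<and> i mod 3 = 2 mod 3}. l i) \<and>
      mult b3 A \<ge> (\<Sum>i\<in>{i. 3 \<le> i \<and> i \<le> H + 1 \<and> i mod 3 = 3 mod 3}. l i) \<and>
      mult b4 A \<ge> (\<Sum>i\<in>{i. 4 \<le> i \<and> i \<le> H + 1 \<and> i mod 3 = 4 mod 3}. l i) \<and>
      mult b4 A < l 3)"

end

(* For a vertex v let f_v be the Schur complement of xI - A obtained by eliminating the
   descendants of v, so f_v = x - a_vv - (sum over the children u of a_vu a_uv / f_u) and
   det (xI - A) is the product of all f_v.  Every f_v is increasing in x, hence has only simple real
   zeros and poles, v is a pole exactly if some child is a zero, and
   mult(lambda) = #zeros - #poles.  Lushness makes it possible to discharge this count from children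
   to parents: alpha_1 and alpha_2 together attain the largest possible total, which forces zeros and
   poles to alternate from level to level; this fixes the diagonal above level 1.  Then no vertex
   above level 1 can vanish at beta if all its children have a pole there, so the same discharging
   shows that the multiplicity demanded of beta_j is the largest possible one and forces the
   period-three pattern zero, pole, neither.  The condition mult(beta_4) < l_3 only serves to exclude
   that beta_4 is a zero at level 2.  Evaluating f_v at the prescribed zeros gives the b_i, and the
   inequalities defining B express the positivity of b_2, b_3, b_4. *)

theory Submission
  imports Defs "HOL-Computational_Algebra.Formal_Laurent_Series" "HOL-Computational_Algebra.Polynomial_FPS"
begin

text \<open>Only lower bounds on a few multiplicities are given, while the entries of
  \<open>A\<close> can be computed only once the order of every f_v at the prescribed values is
  known. Discharging bridges this gap: a nonnegative charge records deviations from the desired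
  pattern, every vertex has a nonnegative balance, and the balances add up to the deficit in the
  multiplicity minus the charge of the root. An attained bound makes all of these zero, and the
  pattern spreads from the root downwards. Zeros and poles at a point x are treated alike by taking
  f_v as its Laurent expansion at x: division is available, the order is the subdegree, and
  monotonicity is a sign condition on two coefficients. The irregular entries a_2, b_2, b_3, b_4
  stem from height 1: leaves have no poles, so the diagonal there is not one of the alpha's, and
  this shows in the next two levels. For H = 2 the list hardly restricts beta_4, so the fifth entry
  of Lambda is then chosen afresh. The spectrum follows because f_v depends on the height of v
  only.\<close>

section \<open>Laurent expansions with positive slope\<close>

text \<open>A pole must be simple with negative residue; elsewhere the derivative must be positive.
  Nothing is asked of the regular part at a pole, and the class is still closed under sums, positive
  multiples and \<open>- inverse f\<close>.\<close>

definition increasing_fls :: "real fls \<Rightarrow> bool" where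
  "increasing_fls f \<longleftrightarrow> (\<forall>k < -1. fls_nth f k = 0) \<and>
     (fls_nth f (-1) < 0 \<or> fls_nth f (-1) = 0 \<and> 0 < fls_nth f 1)"

lemma increasing_fls_nonzero: "increasing_fls f \<Longrightarrow> f \<noteq> 0"
  by (auto simp: increasing_fls_def)

lemma increasing_fls_subdegree_cases [consumes 1, case_names pole unit root]:
  assumes "increasing_fls f"
  obtains (pole) "fls_subdegree f = -1" "fls_nth f (-1) < 0"
  | (unit) "fls_subdegree f = 0" "fls_nth f (-1) = 0" "fls_nth f 0 \<noteq> 0" "fls_nth f 1 > 0"
  | (root) "fls_subdegree f = 1" "fls_nth f (-1) = 0" "fls_nth f 0 = 0" "fls_nth f 1 > 0"
proof (cases "fls_nth f (-1) = 0")
  case False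
  then have "fls_nth f (-1) < 0" using assms by (auto simp: increasing_fls_def)
  moreover have "fls_subdegree f = -1"
    by (rule fls_subdegree_eqI) (use assms False in \<open>auto simp: increasing_fls_def\<close>)
  ultimately show ?thesis using pole by blast
next
  case True
  then have p1: "fls_nth f 1 > 0" using assms by (auto simp: increasing_fls_def)
  have neg: "fls_nth f k = 0" if "k < 0" for k
  proof (cases "k = -1")
    case False
    then have "k < -1" using that by linarith
    then show ?thesis using assms by (auto simp: increasing_fls_def)
  qed (use True in simp)
  show ?thesis
  proof (cases "fls_nth f 0 = 0")
    case False
    have "fls_subdegree f = 0" by (rule fls_subdegree_eqI) (use neg False in auto)
    then show ?thesis using unit True False p1 by blast
  next
    case z: True
    have "fls_subdegree f = 1"
    proof (rule fls_subdegree_eqI)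
      fix k :: int assume "k < 1"
      then show "fls_nth f k = 0" using neg z by (cases "k = 0") auto
    qed (use p1 in auto)
    then show ?thesis using root True z p1 by blast
  qed
qed

lemma increasing_fls_sum:
  assumes "\<And>i. i \<in> I \<Longrightarrow> increasing_fls (f i)" "increasing_fls g"
  shows "increasing_fls (g + (\<Sum>i\<in>I. f i))"
  using assms(1)
proof (induction I rule: infinite_finite_induct)
  case (insert i I)
  have "increasing_fls (f i)" "increasing_fls (g + (\<Sum>i\<in>I. f i))" using insert by auto
  then have "increasing_fls (f i + (g + (\<Sum>i\<in>I. f i)))"
    by (auto simp: increasing_fls_def)
  then show ?case using insert by (simp add: algebra_simps)
qed (use assms(2) in auto)

lemma increasing_fls_const_mult:
  "c > 0 \<Longrightarrow> increasing_fls f \<Longrightarrow> increasing_fls (fls_const c * f)"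
  by (auto simp: increasing_fls_def mult_pos_neg)

lemma increasing_fls_neg_inverse:
  assumes "increasing_fls f"
  shows "increasing_fls (- inverse f)"
proof -
  have nz: "f \<noteq> 0" using assms by (rule increasing_fls_nonzero)
  note base = fls_inverse_base[OF nz]
  have low: "fls_nth (inverse f) k = 0" if "k < - fls_subdegree f" for k
    using that by (intro fls_eq0_below_subdegree) simp
  from assms show ?thesis
  proof (cases rule: increasing_fls_subdegree_cases)
    case pole
    then show ?thesis using base low by (auto simp: increasing_fls_def)
  next
    case root
    then show ?thesis using base low by (auto simp: increasing_fls_def)
  next
    case unit
    \<comment> \<open>The rule (1/f)' = - f'/f^2, read off from coefficient 1 of
      \<open>f * inverse f = 1\<close>.\<close>
    have "fls_nth (f * inverse f) 1 = fls_nth f 0 * fls_nth (inverse f) 1 + fls_nth f 1 * fls_nth (inverse f) 0"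
      using unit(1) by (subst fls_times_nth(2)) (simp add: simp_from_to)
    then have "fls_nth f 0 * fls_nth (inverse f) 1 = - (fls_nth f 1 * inverse (fls_nth f 0))"
      using nz unit base by simp
    then have "fls_nth (inverse f) 1 = - (fls_nth f 1 * inverse (fls_nth f 0) * inverse (fls_nth f 0))"
      using unit by (simp add: field_simps)
    also have "\<dots> < 0" using unit by (simp add: mult.assoc zero_less_mult_iff flip: power2_eq_square)
    finally have "fls_nth (inverse f) 1 < 0" .
    then show ?thesis using unit low by (auto simp: increasing_fls_def)
  qed
qed

lemma increasing_fls_divide_sum:
  assumes "\<And>i. i \<in> I \<Longrightarrow> increasing_fls (f i)" "\<And>i. i \<in> I \<Longrightarrow> c i > 0"
  shows "increasing_fls (fls_X + fls_const b - (\<Sum>i\<in>I. fls_const (c i) / f i))"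
proof -
  have "increasing_fls (fls_X + fls_const b + (\<Sum>i\<in>I. fls_const (c i) * (- inverse (f i))))"
    using assms
    by (intro increasing_fls_sum increasing_fls_const_mult increasing_fls_neg_inverse)
       (auto simp: increasing_fls_def)
  then show ?thesis by (simp add: sum_negf divide_inverse)
qed

section \<open>Expansion of a polynomial at a point\<close>

text \<open>Taylor expansion at x, placed among Laurent series because Schur complements have to be
  inverted. As a ring homomorphism it passes through determinants.\<close>

definition expand_at :: "real \<Rightarrow> real poly \<Rightarrow> real fls" where
  "expand_at x p = fps_to_fls (fps_of_poly (pcompose p [:x, 1:]))"

interpretation expand_at: comm_ring_hom "expand_at x"
  by unfold_locales
     (simp_all add: expand_at_def pcompose_add pcompose_mult pcompose_1 fps_of_poly_add fps_of_poly_mult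
        fls_times_fps_to_fls)

lemma inj_expand_at: "inj (expand_at x)"
proof (rule injI)
  fix p q assume "expand_at x p = expand_at x q"
  then have "pcompose p [:x, 1:] = pcompose q [:x, 1:]"
    by (simp add: expand_at_def fps_of_poly_eq_iff)
  then have "pcompose (pcompose p [:x, 1:]) [:-x, 1:] = pcompose (pcompose q [:x, 1:]) [:-x, 1:]"
    by simp
  then show "p = q" by (simp flip: pcompose_assoc add: pcompose_pCons)
qed

lemma expand_at_const: "expand_at x [:c:] = fls_const c"
  by (simp add: expand_at_def fps_of_poly_const)

lemma expand_at_X: "expand_at x [:0, 1:] = fls_X + fls_const x"
  by (simp add: expand_at_def pcompose_pCons fps_of_poly_linear)

lemma subdegree_expand_at:
  assumes "p \<noteq> 0"
  shows "fls_subdegree (expand_at x p) = int (order x p)"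
proof -
  obtain q where q: "p = [:-x, 1:] ^ order x p * q" "\<not> [:-x, 1:] dvd q"
    using order_decomp[OF assms] by blast
  have "poly q x \<noteq> 0" using q(2) by (simp add: poly_eq_0_iff_dvd)
  then have "fls_nth (expand_at x q) 0 \<noteq> 0"
    by (simp add: expand_at_def flip: poly_0_coeff_0 add: poly_pcompose)
  then have "fls_subdegree (expand_at x q) \<le> 0" "expand_at x q \<noteq> 0"
    by (auto intro: fls_subdegree_leI)
  moreover have "fls_subdegree (expand_at x q) \<ge> 0"
    by (simp add: expand_at_def fls_subdegree_fls_to_fps_gt0)
  moreover have "expand_at x [:-x, 1:] = fls_X"
    by (simp add: expand_at_def pcompose_pCons)
  ultimately show ?thesis
    by (subst q(1)) (simp add: expand_at.hom_mult expand_at.hom_power)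
qed

text \<open>\<open>mult\<close> counts complex roots; embedding the reals keeps the order at a real
  point, so all further work is over the reals.\<close>

lemma mult_eq_order:
  assumes "A \<in> carrier_mat n n"
  shows "mult x A = order x (char_poly A)"
proof -
  interpret map_poly_inj_idom_divide_hom complex_of_real by unfold_locales auto
  have "char_poly (map_mat complex_of_real A) = map_poly complex_of_real (char_poly A)"
    using assms by (rule of_real_hom.char_poly_hom)
  moreover have "char_poly A \<noteq> 0" using degree_monic_char_poly[OF assms] by auto
  ultimately show ?thesis
    by (simp add: mult_def spec_def order_hom)
qed

section \<open>Determinants\<close>

text \<open>Sorted by \<open>h\<close> the matrix would be triangular. Instead of sorting: a
  nonidentity permutation with nonzero product would strictly raise the sum of \<open>h\<close>, but
  permuting cannot change that sum.\<close>

lemma det_graded: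
  fixes M :: "'a :: comm_ring_1 mat" and h :: "nat \<Rightarrow> nat"
  assumes M: "M \<in> carrier_mat n n"
    and grade: "\<And>i j. i < n \<Longrightarrow> j < n \<Longrightarrow> i \<noteq> j \<Longrightarrow> M $$ (i, j) \<noteq> 0 \<Longrightarrow> h i < h j"
  shows "det M = (\<Prod>i<n. M $$ (i, i))"
proof -
  have "(\<Prod>i = 0..<n. M $$ (i, p i)) = 0" if p: "p permutes {0..<n}" "p \<noteq> id" for p
  proof (rule ccontr)
    assume "(\<Prod>i = 0..<n. M $$ (i, p i)) \<noteq> 0"
    then have nz: "M $$ (i, p i) \<noteq> 0" if "i < n" for i
      using that by (meson atLeastLessThan_iff finite_atLeastLessThan le0 prod_zero)
    have lt: "p i < n" if "i < n" for i using permutes_in_image[OF p(1), of i] that by simp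
    have step: "h i < h (p i)" if "i < n" "p i \<noteq> i" for i using grade nz lt that by metis
    obtain k where k: "p k \<noteq> k" using p(2) by (auto simp: fun_eq_iff)
    then have "k < n" using p(1) by (meson atLeastLessThan_iff le0 not_le permutes_not_in)
    have "(\<Sum>i<n. h i) < (\<Sum>i<n. h (p i))"
    proof (rule sum_strict_mono_ex1)
      show "\<forall>i\<in>{..<n}. h i \<le> h (p i)" using step by (metis le_eq_less_or_eq lessThan_iff)
      show "\<exists>i\<in>{..<n}. h i < h (p i)" using step[OF \<open>k < n\<close> k] \<open>k < n\<close> by auto
    qed simp
    moreover have "(\<Sum>i<n. h (p i)) = (\<Sum>i<n. h i)"
      using sum.permute[OF p(1), of h] by (simp add: o_def atLeast0LessThan)
    ultimately show False by simp
  qed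
  then have "det M = (\<Sum>p\<in>{id}. signof p * (\<Prod>i = 0..<n. M $$ (i, p i)))"
    unfolding det_def'[OF M]
    by (intro sum.mono_neutral_right) (auto simp: permutes_id finite_permutations)
  then show ?thesis by (simp add: atLeast0LessThan)
qed

section \<open>Rooted trees and Schur complements\<close>

locale rooted =
  fixes n r :: nat and par :: "nat \<Rightarrow> nat"
  assumes tree: "rooted_tree n r par"
begin

abbreviation kids :: "nat \<Rightarrow> nat set" where
  "kids \<equiv> children n r par"

definition depth :: "nat \<Rightarrow> nat" where
  "depth v = (LEAST k. (par ^^ k) v = r)"

lemma root_less: "r < n" and par_less: "v < n \<Longrightarrow> v \<noteq> r \<Longrightarrow> par v < n"
  and reaches_root: "v < n \<Longrightarrow> \<exists>k. (par ^^ k) v = r"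
  using tree by (auto simp: rooted_tree_def)

lemma kids_iff: "u \<in> kids v \<longleftrightarrow> u < n \<and> v < n \<and> u \<noteq> r \<and> par u = v"
  by (auto simp: children_def is_child_def)

lemma kids_subset: "kids v \<subseteq> {..<n}" by (auto simp: kids_iff)

lemma finite_kids [simp]: "finite (kids v)"
  using kids_subset finite_subset by blast

lemma depth_root [simp]: "depth r = 0"
  by (simp add: depth_def)

lemma depth_par:
  assumes "v < n" "v \<noteq> r"
  shows "depth v = Suc (depth (par v))"
proof -
  obtain k where k: "(par ^^ k) v = r" using reaches_root assms by blast
  have "(LEAST k. (par ^^ k) v = r) = Suc (LEAST k. (par ^^ Suc k) v = r)"
    by (rule Least_Suc[where P = "\<lambda>k. (par ^^ k) v = r", OF k]) (use assms in simp)
  then show ?thesis by (simp add: depth_def funpow_swap1)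
qed

lemma depth_kid: "u \<in> kids v \<Longrightarrow> depth u = Suc (depth v)"
  using depth_par by (auto simp: kids_iff)

lemma depth_eq_0: "v < n \<Longrightarrow> depth v = 0 \<longleftrightarrow> v = r"
  using depth_par by force

text \<open>Every vertex other than the root is a kid of exactly one vertex; this double count is
  what discharging rests on.\<close>

lemma sum_kids:
  fixes g :: "nat \<Rightarrow> 'a :: comm_monoid_add"
  shows "(\<Sum>v<n. g v) = g r + (\<Sum>v<n. \<Sum>u\<in>kids v. g u)"
proof -
  have "(\<Sum>v<n. \<Sum>u\<in>kids v. g u) = (\<Sum>u\<in>(\<Union>v<n. kids v). g u)"
    by (rule sum.UNION_disjoint[symmetric]) (auto simp: kids_iff)
  also have "(\<Union>v<n. kids v) = {..<n} - {r}"
    by (auto simp: kids_iff dest: par_less)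
  finally show ?thesis using root_less by (simp add: sum.remove)
qed

lemma adj_iff_kids: "adj n r par u v \<longleftrightarrow> u \<in> kids v \<or> v \<in> kids u"
  by (auto simp: adj_def kids_iff)

end

locale weighted_tree = rooted +
  fixes A :: "real mat"
  assumes in_R: "in_R n r par A"
begin

abbreviation wt :: "nat \<Rightarrow> nat \<Rightarrow> real" where
  "wt v u \<equiv> A $$ (v, u) * A $$ (u, v)"

lemma carrier_A: "A \<in> carrier_mat n n"
  using in_R by (simp add: in_R_def)

lemma wt_pos: "u \<in> kids v \<Longrightarrow> wt v u > 0"
  using in_R by (auto simp: in_R_def adj_iff_kids kids_iff)

lemma A_zero: "i < n \<Longrightarrow> j < n \<Longrightarrow> i \<noteq> j \<Longrightarrow> i \<notin> kids j \<Longrightarrow> j \<notin> kids i \<Longrightarrow> A $$ (i, j) = 0"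
  using in_R by (auto simp: in_R_def adj_iff_kids)

primrec schur_fuel :: "real \<Rightarrow> nat \<Rightarrow> nat \<Rightarrow> real fls" where
  "schur_fuel x 0 v = 0"
| "schur_fuel x (Suc k) v = fls_X + fls_const (x - A $$ (v, v)) -
     (\<Sum>u\<in>kids v. fls_const (wt v u) / schur_fuel x k u)"

text \<open>The recursion descends the tree; \<open>\<Sum>u<n. depth u\<close> bounds every depth, so the fuel never runs out.\<close>

definition schur :: "real \<Rightarrow> nat \<Rightarrow> real fls" where
  "schur x v = schur_fuel x (Suc (\<Sum>u<n. depth u) - depth v) v"

lemma schur_rec:
  assumes "v < n"
  shows "schur x v = fls_X + fls_const (x - A $$ (v, v)) - (\<Sum>u\<in>kids v. fls_const (wt v u) / schur x u)"
proof -
  have bound: "depth u \<le> (\<Sum>u<n. depth u)" if "u < n" for u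
    using that by (intro member_le_sum) auto
  have "Suc (\<Sum>u<n. depth u) - depth v = Suc ((\<Sum>u<n. depth u) - depth v)"
    using bound[OF assms] by simp
  moreover have "Suc (\<Sum>u<n. depth u) - depth u = (\<Sum>u<n. depth u) - depth v" if "u \<in> kids v" for u
    using depth_kid[OF that] by simp
  ultimately show ?thesis by (simp add: schur_def)
qed

lemma increasing_schur: "v < n \<Longrightarrow> increasing_fls (schur x v)"
proof (induction "(\<Sum>u<n. depth u) - depth v" arbitrary: v rule: less_induct)
  case less
  have "increasing_fls (schur x u)" if u: "u \<in> kids v" for u
  proof (rule less.hyps)
    have "u < n" using u by (simp add: kids_iff)
    then have "depth u \<le> (\<Sum>u<n. depth u)" by (intro member_le_sum) auto
    then show "(\<Sum>u<n. depth u) - depth u < (\<Sum>u<n. depth u) - depth v"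
      using depth_kid[OF u] by simp
  qed (use u in \<open>simp add: kids_iff\<close>)
  then show ?case
    unfolding schur_rec[OF less.prems] by (intro increasing_fls_divide_sum wt_pos)
qed

lemma schur_nonzero: "v < n \<Longrightarrow> schur x v \<noteq> 0"
  using increasing_schur increasing_fls_nonzero by blast

text \<open>Eliminating the vertices from the leaves to the root factors \<open>xI - A\<close> as
  \<open>L D U\<close>, where \<open>D\<close> is the diagonal of Schur complements and the off-diagonal entries of
  \<open>L\<close> and \<open>U\<close> sit on the edges.\<close>

lemma expand_at_char_poly: "expand_at x (char_poly A) = (\<Prod>v<n. schur x v)"
proof -
  define f where "f = schur x"
  define c :: "real \<Rightarrow> real fls" where "c = fls_const"
  define L where "L = mat n n (\<lambda>(i, j). if i = j then 1 else if j \<in> kids i then - c (A $$ (i, j)) / f j else 0)"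
  define D where "D = mat n n (\<lambda>(i, j). if i = j then f i else 0)"
  define U where "U = mat n n (\<lambda>(i, j). if i = j then 1 else if i \<in> kids j then - c (A $$ (i, j)) / f i else 0)"
  have nz: "f v \<noteq> 0" if "v < n" for v using that schur_nonzero by (simp add: f_def)
  have car: "L \<in> carrier_mat n n" "D \<in> carrier_mat n n" "U \<in> carrier_mat n n"
    by (auto simp: L_def D_def U_def)
  have no_loop: "v \<notin> kids v" for v using depth_kid by fastforce
  have DU: "(D * U) $$ (k, j) = f k * U $$ (k, j)" if "k < n" "j < n" for k j
  proof -
    have "(D * U) $$ (k, j) = (\<Sum>l = 0..<n. D $$ (k, l) * U $$ (l, j))"
      using that car by (simp add: scalar_prod_def)
    also have "\<dots> = (\<Sum>l = 0..<n. if l = k then f k * U $$ (k, j) else 0)"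
      using that by (intro sum.cong) (auto simp: D_def)
    finally show ?thesis using that by simp
  qed
  have LDU: "(L * (D * U)) $$ (i, j) = (\<Sum>k<n. L $$ (i, k) * f k * U $$ (k, j))" if "i < n" "j < n" for i j
  proof -
    have "(L * (D * U)) $$ (i, j) = (\<Sum>k = 0..<n. L $$ (i, k) * (D * U) $$ (k, j))"
      using that car by (simp add: scalar_prod_def)
    also have "\<dots> = (\<Sum>k = 0..<n. L $$ (i, k) * f k * U $$ (k, j))"
      using that by (intro sum.cong) (auto simp: DU)
    finally show ?thesis by (simp add: atLeast0LessThan)
  qed
  have eq: "map_mat (expand_at x) (char_poly_matrix A) = L * (D * U)"
  proof (rule eq_matI)
    fix i j assume ij': "i < dim_row (L * (D * U))" "j < dim_col (L * (D * U))"
    then have ij: "i < n" "j < n" using car by auto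
    have lhs: "map_mat (expand_at x) (char_poly_matrix A) $$ (i, j)
        = (if i = j then fls_X + c x else 0) - c (A $$ (i, j))"
      using ij carrier_A
      by (auto simp: char_poly_matrix_def expand_at.hom_add expand_at_X[folded one_pCons] expand_at_const c_def
          simp del: add_pCons)
    have rhs: "(L * (D * U)) $$ (i, j) = (\<Sum>k<n. (if k = i then f i * U $$ (i, j) else 0)
         + (if k \<in> kids i then - c (A $$ (i, k)) * U $$ (k, j) else 0))"
      unfolding LDU[OF ij] using ij nz no_loop by (intro sum.cong) (auto simp: L_def)
    have "\<dots> = f i * U $$ (i, j) + (\<Sum>k\<in>kids i. - c (A $$ (i, k)) * U $$ (k, j))"
    proof -
      have "(\<Sum>k<n. if k \<in> kids i then - c (A $$ (i, k)) * U $$ (k, j) else 0)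
          = (\<Sum>k\<in>kids i. - c (A $$ (i, k)) * U $$ (k, j))"
        using kids_subset[of i] by (subst sum.inter_restrict[symmetric]) (auto simp: Int_absorb1)
      then show ?thesis using ij by (simp add: sum.distrib)
    qed
    \<comment> \<open>On the diagonal the sum over the kids cancels the one in
      \<open>schur_rec\<close>; off the diagonal at most one of the two terms survives, since i and
      j cannot be kids of each other.\<close>
    also have "\<dots> = (if i = j then fls_X + c x else 0) - c (A $$ (i, j))"
    proof (cases "i = j")
      case True
      have "(\<Sum>k\<in>kids i. - c (A $$ (i, k)) * U $$ (k, j)) = (\<Sum>k\<in>kids i. c (wt i k) / f k)"
      proof (intro sum.cong refl)
        fix k assume k: "k \<in> kids i"
        then have "k < n" "k \<noteq> i" using kids_subset no_loop by auto
        then show "- c (A $$ (i, k)) * U $$ (k, j) = c (wt i k) / f k"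
          using True ij k by (simp add: U_def c_def flip: fls_const_mult_const)
      qed
      moreover have "U $$ (i, j) = 1" using True ij by (simp add: U_def)
      moreover have "f i = fls_X + c (x - A $$ (i, i)) - (\<Sum>k\<in>kids i. c (wt i k) / f k)"
        using schur_rec[OF ij(1)] by (simp add: f_def c_def)
      ultimately show ?thesis using True by (simp add: c_def flip: fls_minus_const)
    next
      case False
      have "(\<Sum>k\<in>kids i. - c (A $$ (i, k)) * U $$ (k, j)) = (\<Sum>k\<in>kids i. if k = j then - c (A $$ (i, k)) else 0)"
        using False ij no_loop by (intro sum.cong) (auto simp: U_def kids_iff)
      also have "\<dots> = (if j \<in> kids i then - c (A $$ (i, j)) else 0)" by simp
      finally have s: "(\<Sum>k\<in>kids i. - c (A $$ (i, k)) * U $$ (k, j)) = (if j \<in> kids i then - c (A $$ (i, j)) else 0)" .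
      have "f i * U $$ (i, j) = (if i \<in> kids j then - c (A $$ (i, j)) else 0)"
        using False ij nz by (simp add: U_def)
      moreover have "\<not> (i \<in> kids j \<and> j \<in> kids i)"
        using depth_kid[of i j] depth_kid[of j i] by auto
      ultimately show ?thesis using s False A_zero[OF ij False] by (auto simp: c_def)
    qed
    finally show "map_mat (expand_at x) (char_poly_matrix A) $$ (i, j) = (L * (D * U)) $$ (i, j)"
      using lhs rhs by simp
  qed (use car carrier_A char_poly_matrix_closed in auto)
  have "det L = (\<Prod>i<n. L $$ (i, i))"
    by (rule det_graded[of _ _ depth]) (use depth_kid in \<open>auto simp: L_def split: if_splits\<close>)
  \<comment> \<open>The entries of \<open>U\<close> lead from kid to parent, so the grading by depth
    fits its transpose.\<close>
  moreover have "det (transpose_mat U) = (\<Prod>i<n. transpose_mat U $$ (i, i))"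
    by (rule det_graded[of _ _ depth]) (use depth_kid in \<open>auto simp: U_def split: if_splits\<close>)
  moreover have "det D = (\<Prod>i<n. D $$ (i, i))"
    by (rule det_graded[of _ _ depth]) (auto simp: D_def)
  moreover have "det (L * (D * U)) = det L * (det D * det U)"
    using car by (simp add: det_mult[of _ n])
  ultimately have "det (L * (D * U)) = (\<Prod>v<n. f v)"
    using car det_transpose[of U n] by (simp add: L_def U_def D_def)
  then show ?thesis
    unfolding char_poly_def using eq by (simp add: f_def flip: expand_at.hom_det)
qed

section \<open>Zeros and poles of the Schur complements at a point\<close>

lemma char_poly_nonzero: "char_poly A \<noteq> 0"
  using degree_monic_char_poly[OF carrier_A] by auto

text \<open>1 at a zero of f_v, -1 at a pole, 0 otherwise; monotonicity leaves no other
  case.\<close>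

definition ord :: "real \<Rightarrow> nat \<Rightarrow> int" where
  "ord x v = fls_subdegree (schur x v)"

lemma mult_eq_sum_ord: "int (mult x A) = (\<Sum>v<n. ord x v)"
proof -
  have "int (mult x A) = fls_subdegree (expand_at x (char_poly A))"
    using subdegree_expand_at char_poly_nonzero mult_eq_order[OF carrier_A] by simp
  then show ?thesis
    unfolding expand_at_char_poly ord_def by (subst (asm) fls_subdegree_prod) (auto simp: schur_nonzero)
qed

text \<open>The number f_v(x), provided that x is not a pole.\<close>

definition val :: "real \<Rightarrow> nat \<Rightarrow> real" where
  "val x v = fls_nth (schur x v) 0"

lemma ord_cases:
  assumes "v < n"
  obtains "ord x v = -1" | "ord x v = 0" | "ord x v = 1"
  using increasing_schur[OF assms, of x] unfolding ord_def
  by (cases rule: increasing_fls_subdegree_cases) auto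

text \<open>A kid that is a zero has positive derivative and positive edge weight, so it contributes
  a negative residue; contributions of several kids cannot cancel.\<close>

lemma ord_pole_iff:
  assumes "v < n"
  shows "ord x v = -1 \<longleftrightarrow> (\<exists>u\<in>kids v. ord x u = 1)"
proof -
  have coeff: "fls_nth (inverse (schur x u)) (-1) = (if ord x u = 1 then inverse (fls_nth (schur x u) 1) else 0)"
    and pos: "ord x u = 1 \<Longrightarrow> fls_nth (schur x u) 1 > 0" if "u \<in> kids v" for u
  proof -
    have u: "u < n" using that by (simp add: kids_iff)
    from increasing_schur[OF u, of x]
    show "fls_nth (inverse (schur x u)) (-1) = (if ord x u = 1 then inverse (fls_nth (schur x u) 1) else 0)"
      using fls_inverse_base[OF schur_nonzero[OF u, of x]] unfolding ord_def
      by (cases rule: increasing_fls_subdegree_cases) (auto intro: fls_eq0_below_subdegree)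
    from increasing_schur[OF u, of x] show "ord x u = 1 \<Longrightarrow> fls_nth (schur x u) 1 > 0"
      unfolding ord_def by (cases rule: increasing_fls_subdegree_cases) auto
  qed
  define t where "t u = (if ord x u = 1 then wt v u * inverse (fls_nth (schur x u) 1) else 0)" for u
  have "fls_nth (schur x v) (-1) = - (\<Sum>u\<in>kids v. t u)"
    unfolding schur_rec[OF assms]
    by (simp add: fls_nth_sum divide_inverse, intro sum.cong) (simp_all add: coeff t_def)
  moreover have tnn: "t u \<ge> 0" if "u \<in> kids v" for u
    using wt_pos[OF that] pos[OF that] by (auto simp: t_def intro!: mult_nonneg_nonneg[of "wt v u"])
  moreover have "t u = 0 \<longleftrightarrow> ord x u \<noteq> 1" if "u \<in> kids v" for u
    using wt_pos[OF that] pos[OF that] by (auto simp: t_def)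
  ultimately have "fls_nth (schur x v) (-1) = 0 \<longleftrightarrow> (\<forall>u\<in>kids v. ord x u \<noteq> 1)"
    using sum_nonneg_eq_0_iff[of "kids v" t] by simp
  moreover from increasing_schur[OF assms, of x]
  have "ord x v = -1 \<longleftrightarrow> fls_nth (schur x v) (-1) \<noteq> 0"
    unfolding ord_def by (cases rule: increasing_fls_subdegree_cases) auto
  ultimately show ?thesis by blast
qed

lemma ord_root_iff: "v < n \<Longrightarrow> ord x v = 1 \<longleftrightarrow> ord x v \<noteq> -1 \<and> val x v = 0"
  using increasing_schur[of v x] unfolding ord_def val_def
  by (cases rule: increasing_fls_subdegree_cases) auto

text \<open>If v has no pole then no kid is a zero, and a kid with a pole contributes nothing
  because its reciprocal vanishes. Only kids of order 0 remain.\<close>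

lemma val_eq:
  assumes "v < n" "ord x v \<noteq> -1"
  shows "val x v = x - A $$ (v, v) - (\<Sum>u\<in>kids v. if ord x u = 0 then wt v u / val x u else 0)"
proof -
  have "fls_nth (inverse (schur x u)) 0 = (if ord x u = 0 then 1 / val x u else 0)" if "u \<in> kids v" for u
  proof -
    have u: "u < n" "ord x u \<noteq> 1" using that assms ord_pole_iff by (auto simp: kids_iff)
    from increasing_schur[OF u(1), of x] show ?thesis
      using u fls_inverse_base[OF schur_nonzero[OF u(1), of x]] unfolding ord_def val_def
      by (cases rule: increasing_fls_subdegree_cases) (auto simp: divide_inverse intro: fls_eq0_below_subdegree)
  qed
  then have "(\<Sum>u\<in>kids v. fls_nth (fls_const (wt v u) / schur x u) 0)
      = (\<Sum>u\<in>kids v. if ord x u = 0 then wt v u / val x u else 0)"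
    by (intro sum.cong) (auto simp: divide_inverse)
  then show ?thesis
    unfolding val_def[of x v] schur_rec[OF assms(1)] by (simp add: fls_nth_sum)
qed

end

section \<open>Heights in hedges\<close>

context rooted
begin

lemma adj_sym: "adj n r par u v \<Longrightarrow> adj n r par v u"
  by (auto simp: adj_def)

lemma walk_snoc: "walk n r par u w k \<Longrightarrow> adj n r par w v \<Longrightarrow> walk n r par u v (Suc k)"
proof (induction rule: walk.induct)
  case (walk0 u)
  then show ?case by (metis adj_def walk.intros)
next
  case (walkS u w v k)
  then show ?case using walk.walkS by blast
qed

lemma walk_sym: "walk n r par u v k \<Longrightarrow> walk n r par v u k"
proof (induction rule: walk.induct)
  case (walk0 u)
  then show ?case by (rule walk.walk0)
next
  case (walkS u w v k)
  then show ?case using walk_snoc adj_sym by blast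
qed

lemma walk_trans: "walk n r par u w k \<Longrightarrow> walk n r par w v l \<Longrightarrow> walk n r par u v (k + l)"
  by (induction rule: walk.induct) (auto intro: walk.walkS)

lemma adj_depth: "adj n r par u v \<Longrightarrow> depth v \<le> Suc (depth u) \<and> depth u \<le> Suc (depth v)"
  using depth_kid[of u v] depth_kid[of v u] by (auto simp: adj_iff_kids)

lemma walk_depth: "walk n r par u v k \<Longrightarrow> depth v \<le> depth u + k"
proof (induction rule: walk.induct)
  case (walkS u w v k)
  then show ?case using adj_depth[of u w] by simp
qed simp

lemma walk_from_root: "v < n \<Longrightarrow> walk n r par r v (depth v)"
proof (induction "depth v" arbitrary: v)
  case 0
  then show ?case using depth_eq_0 walk.walk0 by fastforce
next
  case (Suc d)
  then have "v \<noteq> r" by auto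
  then have "adj n r par (par v) v" "depth v = Suc (depth (par v))"
    using Suc.prems par_less depth_par by (auto simp: adj_def)
  then show ?case
    using Suc walk_snoc[of r "par v" "depth (par v)" v] par_less \<open>v \<noteq> r\<close> by auto
qed

lemma dist_root: "v < n \<Longrightarrow> dist n r par r v = depth v"
  unfolding dist_def by (rule Least_equality) (auto dest: walk_depth intro: walk_from_root)

lemma ex_walk: "u < n \<Longrightarrow> v < n \<Longrightarrow> \<exists>k. walk n r par u v k"
  by (rule exI, rule walk_trans[OF walk_sym walk_from_root]) (rule walk_from_root)

lemma root_has_kid:
  assumes "v < n" "v \<noteq> r"
  shows "kids r \<noteq> {}"
  using assms
proof (induction "depth v" arbitrary: v rule: less_induct)
  case less
  then show ?case
  proof (cases "par v = r")
    case True
    then have "v \<in> kids r" using less.prems root_less by (simp add: kids_iff)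
    then show ?thesis by blast
  next
    case False
    then show ?thesis using less.hyps[of "par v"] less.prems par_less[of v] depth_par[of v] by simp
  qed
qed

text \<open>The root has a kid and is no leaf; any other vertex has degree one more than its number
  of kids.\<close>

lemma leaf_iff:
  assumes "n \<noteq> 1"
  shows "is_leaf n r par v \<longleftrightarrow> v < n \<and> kids v = {}"
proof (cases "v < n")
  case v: True
  show ?thesis
  proof (cases "v = r")
    case True
    have "\<exists>u<n. u \<noteq> r"
    proof (cases "r = 0")
      case True
      then show ?thesis using assms root_less by (intro exI[of _ 1]) auto
    next
      case False
      then show ?thesis using root_less by (intro exI[of _ 0]) auto
    qed
    then show ?thesis using True root_has_kid assms by (auto simp: is_leaf_def)
  next
    case False
    have "{w. adj n r par v w} = insert (par v) (kids v)"
      using v False by (auto simp: adj_def kids_iff dest: par_less)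
    moreover have "par v \<notin> kids v"
      using depth_kid[of "par v" v] depth_par[OF v False] by linarith
    ultimately have "degree n r par v = Suc (card (kids v))"
      by (simp add: degree_def)
    then show ?thesis using v False assms by (simp add: is_leaf_def)
  qed
qed (simp add: is_leaf_def)

lemma leaf_below:
  assumes "n \<noteq> 1" "v < n"
  shows "\<exists>l k. is_leaf n r par l \<and> walk n r par v l k \<and> depth l = depth v + k"
  using assms(2)
proof (induction "(\<Sum>u<n. depth u) - depth v" arbitrary: v rule: less_induct)
  case less
  show ?case
  proof (cases "kids v = {}")
    case True
    then show ?thesis using less.prems leaf_iff[OF assms(1)] walk.walk0 by fastforce
  next
    case False
    then obtain u where u: "u \<in> kids v" by blast
    then have "u < n" by (simp add: kids_iff)
    then have "depth u \<le> (\<Sum>u<n. depth u)" by (intro member_le_sum) auto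
    then obtain l k where "is_leaf n r par l" "walk n r par u l k" "depth l = depth u + k"
      using less.hyps[of u] depth_kid[OF u] \<open>u < n\<close> by (metis Suc_le_eq diff_less_mono2 lessI)
    moreover have "adj n r par v u" using u by (simp add: adj_iff_kids)
    ultimately show ?thesis using depth_kid[OF u] walk.walkS by fastforce
  qed
qed

text \<open>All leaves have equal depth. Descending from v reaches one in as many steps as the
  depths differ, and no walk is shorter because each step changes the depth by one at most.\<close>

lemma hgt_plus_depth:
  assumes "is_hedge n r par" "n \<noteq> 1" "v < n"
  shows "hgt n r par v + depth v = hedge_height n r par"
proof -
  obtain l0 where l0: "is_leaf n r par l0"
    using leaf_below[OF assms(2) root_less] by blast
  have leaf_less: "l < n" if "is_leaf n r par l" for l using that by (simp add: is_leaf_def)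
  have leaf_depth: "depth l = depth l0" if "is_leaf n r par l" for l
  proof -
    have "dist n r par r l = dist n r par r l0"
      using assms(1,2) that l0 unfolding is_hedge_def by blast
    then show ?thesis using dist_root leaf_less that l0 by simp
  qed
  have hgt_eq: "hgt n r par v = depth l0 - depth v \<and> depth v \<le> depth l0" if v: "v < n" for v
  proof -
    obtain l k where l: "is_leaf n r par l" "walk n r par v l k" "depth l = depth v + k"
      using leaf_below[OF assms(2) v] by blast
    have low: "depth l0 - depth v \<le> dist n r par v l'" if "is_leaf n r par l'" for l'
    proof -
      have "walk n r par v l' (dist n r par v l')"
        unfolding dist_def using ex_walk[OF v leaf_less[OF that]] by (rule LeastI_ex)
      then show ?thesis using walk_depth leaf_depth[OF that] by fastforce
    qed
    have "dist n r par v l \<le> k" unfolding dist_def using l(2) by (rule Least_le)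
    moreover have "k = depth l0 - depth v" using l(3) leaf_depth[OF l(1)] by simp
    ultimately have "dist n r par v l = depth l0 - depth v" using low[OF l(1)] by simp
    then have "hgt n r par v = depth l0 - depth v"
      unfolding hgt_def using l(1) low by (intro Least_equality) auto
    then show ?thesis using l(3) leaf_depth[OF l(1)] by simp
  qed
  show ?thesis using hgt_eq[OF assms(3)] hgt_eq[OF root_less] by (simp add: hedge_height_def)
qed

end

section \<open>Level sizes of a lush hedge\<close>

locale lush_hedge = weighted_tree +
  assumes lush: "lush n r par" and height_ge_2: "hedge_height n r par \<ge> 2"
begin

abbreviation H :: nat where "H \<equiv> hedge_height n r par"
abbreviation h :: "nat \<Rightarrow> nat" where "h \<equiv> hgt n r par"

lemma n_neq_1: "n \<noteq> 1"
proof
  assume "n = 1"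
  then have "is_leaf n r par r" "dist n r par r r = 0"
    using root_less dist_root[OF root_less] by (auto simp only: is_leaf_def depth_root)
  then have "hgt n r par r = 0" unfolding hgt_def by (intro Least_equality) auto
  then show False using height_ge_2 by (simp add: hedge_height_def)
qed

lemma h_plus_depth: "v < n \<Longrightarrow> h v + depth v = H"
  using hgt_plus_depth n_neq_1 lush by (auto simp: lush_def)

lemma h_le: "v < n \<Longrightarrow> h v \<le> H"
  by (drule h_plus_depth) linarith

lemma h_root [simp]: "h r = H"
  by (simp add: hedge_height_def)

lemma h_kid: "u \<in> kids v \<Longrightarrow> h v = Suc (h u)"
  using h_plus_depth[of u] h_plus_depth[of v] depth_kid[of u v] kids_iff[of u v] by linarith

lemma card_kids:
  assumes "v < n" "h v \<ge> 1"
  shows "card (kids v) \<ge> (if h v = 1 then 2 else 3)"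
  using lush assms by (auto simp: lush_def)

lemma kids_empty_iff: "v < n \<Longrightarrow> kids v = {} \<longleftrightarrow> h v = 0"
proof -
  assume v: "v < n"
  show ?thesis
  proof (cases "h v = 0")
    case True
    then show ?thesis using h_kid by fastforce
  next
    case False
    then have "card (kids v) > 0" using card_kids[OF v] by (cases "h v = 1") auto
    then show ?thesis using False by (metis card.empty less_irrefl)
  qed
qed

lemma leaf_iff_h: "is_leaf n r par v \<longleftrightarrow> v < n \<and> h v = 0"
  using leaf_iff[OF n_neq_1] kids_empty_iff by blast

lemma card_kids_bound: "v < n \<Longrightarrow> h v \<ge> 1 \<Longrightarrow> int (card (kids v)) \<ge> 2"
  and card_kids_bound3: "v < n \<Longrightarrow> h v \<ge> 2 \<Longrightarrow> int (card (kids v)) \<ge> 3"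
  using card_kids[of v] by (auto split: if_splits)

lemma ex_height: "i \<le> H \<Longrightarrow> \<exists>v<n. h v = i"
proof (induction "H - i" arbitrary: i)
  case 0
  then show ?case using root_less by (intro exI[of _ r]) auto
next
  case (Suc d)
  then have "d = H - Suc i" "Suc i \<le> H" by linarith+
  then obtain v where v: "v < n" "h v = Suc i" using Suc.hyps(1)[of "Suc i"] by blast
  then have "kids v \<noteq> {}" using kids_empty_iff by simp
  then obtain u where "u \<in> kids v" by blast
  then show ?case using h_kid[of u v] v by (auto simp: kids_iff)
qed

text \<open>Makes the truncated subtraction in \<open>ell\<close> exact.\<close>

lemma card_Vlev_Suc_le: "card (Vlev n r par (Suc i)) \<le> card (Vlev n r par i)"
proof -
  have "card (Vlev n r par (Suc i)) \<le> (\<Sum>v\<in>Vlev n r par (Suc i). card (kids v))"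
  proof (subst card_eq_sum, intro sum_mono)
    fix v assume "v \<in> Vlev n r par (Suc i)"
    then have "kids v \<noteq> {}" using kids_empty_iff by (simp add: Vlev_def)
    then show "1 \<le> card (kids v)" by (simp add: Suc_le_eq card_gt_0_iff)
  qed
  also have "\<dots> = card (\<Union>v\<in>Vlev n r par (Suc i). kids v)"
    by (rule card_UN_disjoint[symmetric]) (auto simp: Vlev_def kids_iff)
  also have "\<dots> \<le> card (Vlev n r par i)"
  proof (rule card_mono)
    show "(\<Union>v\<in>Vlev n r par (Suc i). kids v) \<subseteq> Vlev n r par i"
    proof
      fix u assume "u \<in> (\<Union>v\<in>Vlev n r par (Suc i). kids v)"
      then obtain v where "h v = Suc i" "u \<in> kids v" by (auto simp: Vlev_def)
      then show "u \<in> Vlev n r par i" using h_kid[of u v] kids_subset by (auto simp: Vlev_def)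
    qed
  qed (simp add: Vlev_def)
  finally show ?thesis .
qed

lemma card_Vlev_eq: "int (card (Vlev n r par i)) = (\<Sum>v<n. of_bool (h v = i))"
proof -
  have "Vlev n r par i = {v \<in> {..<n}. h v = i}" by (auto simp: Vlev_def)
  then show ?thesis
    by (simp only: card_eq_sum sum.inter_filter[OF finite_lessThan] of_bool_def of_nat_sum if_distrib[of int])
      (simp cong: if_cong)
qed

text \<open>A vertex of height k counts positively in l_(k+1) and negatively in l_k. For a leaf the
  negative index would be 0, which lies outside the range; hence \<open>P 0\<close> has to
  fail.\<close>

lemma sum_ell:
  assumes "\<not> P 0"
  shows "(\<Sum>i | 1 \<le> i \<and> i \<le> H + 1 \<and> P i. int (ell n r par i))
    = (\<Sum>v<n. of_bool (P (Suc (h v))) - of_bool (P (h v)))"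
proof -
  let ?I = "{i. 1 \<le> i \<and> i \<le> H + 1 \<and> P i}"
  have fin: "finite ?I" by (rule finite_subset[of _ "{..H + 1}"]) auto
  have "(\<Sum>i\<in>?I. int (ell n r par i)) = (\<Sum>i\<in>?I. \<Sum>v<n. of_bool (h v = i - 1) - of_bool (h v = i))"
  proof (rule sum.cong[OF refl])
    fix i assume "i \<in> ?I"
    then have "card (Vlev n r par i) \<le> card (Vlev n r par (i - 1))"
      using card_Vlev_Suc_le[of "i - 1"] by simp
    then show "int (ell n r par i) = (\<Sum>v<n. of_bool (h v = i - 1) - of_bool (h v = i))"
      by (simp add: ell_def card_Vlev_eq of_nat_diff sum_subtractf)
  qed
  also have "\<dots> = (\<Sum>v<n. \<Sum>i\<in>?I. of_bool (h v = i - 1) - of_bool (h v = i))"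
    by (rule sum.swap)
  also have "\<dots> = (\<Sum>v<n. of_bool (P (Suc (h v))) - of_bool (P (h v)))"
  proof (rule sum.cong[OF refl])
    fix v assume "v \<in> {..<n}"
    then have v: "v < n" by simp
    have "(\<Sum>i\<in>?I. of_bool (h v = i - 1) :: int) = (\<Sum>i\<in>?I. if i = Suc (h v) then 1 else 0)"
      by (rule sum.cong) auto
    also have "\<dots> = of_bool (P (Suc (h v)))" using fin h_le[OF v] by (simp add: sum.delta)
    finally have 1: "(\<Sum>i\<in>?I. of_bool (h v = i - 1) :: int) = of_bool (P (Suc (h v)))" .
    have "(\<Sum>i\<in>?I. of_bool (h v = i) :: int) = (\<Sum>i\<in>?I. if i = h v then 1 else 0)"
      by (rule sum.cong) auto
    also have "\<dots> = of_bool (P (h v))"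
      using fin h_le[OF v] assms by (cases "h v = 0") (simp_all add: sum.delta)
    finally show "(\<Sum>i\<in>?I. of_bool (h v = i - 1) - of_bool (h v = i))
        = (of_bool (P (Suc (h v))) - of_bool (P (h v)) :: int)"
      using 1 by (simp add: sum_subtractf)
  qed
  finally show ?thesis .
qed

section \<open>Discharging along the hedge\<close>

lemma sum_kids_height:
  assumes "i < H"
  shows "(\<Sum>v<n. \<Sum>u\<in>kids v. of_bool (h u = i)) = int (card (Vlev n r par i))"
  using sum_kids[of "\<lambda>v. of_bool (h v = i) :: int"] assms by (simp add: card_Vlev_eq)

lemma sum_kids_of_height:
  "(\<Sum>u\<in>kids v. of_bool (h u = i)) = of_bool (h v = Suc i) * int (card (kids v))"
proof -
  have "(\<Sum>u\<in>kids v. of_bool (h u = i) :: int) = (\<Sum>u\<in>kids v. of_bool (h v = Suc i))"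
    using h_kid by (intro sum.cong) auto
  then show ?thesis by simp
qed

lemma card_Vlev_Suc:
  assumes "i < H"
  shows "2 * card (Vlev n r par (Suc i)) \<le> card (Vlev n r par i)"
proof -
  have "2 * int (card (Vlev n r par (Suc i))) = (\<Sum>v<n. of_bool (h v = Suc i) * 2)"
    by (simp only: card_Vlev_eq sum_distrib_right mult.commute[of 2])
  also have "\<dots> \<le> (\<Sum>v<n. of_bool (h v = Suc i) * int (card (kids v)))"
    using card_kids_bound by (intro sum_mono) auto
  also have "\<dots> = int (card (Vlev n r par i))"
    unfolding sum_kids_height[OF assms, symmetric] sum_kids_of_height ..
  finally show ?thesis by linarith
qed

lemma ell_pos:
  assumes "i \<le> H"
  shows "ell n r par (Suc i) \<ge> 1"
proof -
  obtain v where "v < n" "h v = i" using ex_height[OF assms] by blast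
  then have pos: "card (Vlev n r par i) > 0" by (auto simp: Vlev_def card_gt_0_iff)
  show ?thesis
  proof (cases "i < H")
    case True
    then show ?thesis using card_Vlev_Suc pos by (fastforce simp: ell_def)
  next
    case False
    have "Vlev n r par (Suc i) = {}" using h_le False by (fastforce simp: Vlev_def)
    then show ?thesis using pos by (simp add: ell_def)
  qed
qed

text \<open>Every vertex \<open>v\<close> sends the charge \<open>\<phi> v\<close> to its parent; the root keeps its charge.\<close>

lemma discharge_sum:
  fixes c \<phi> :: "nat \<Rightarrow> int"
  shows "(\<Sum>v<n. c v - \<phi> v + (\<Sum>u\<in>kids v. \<phi> u)) = (\<Sum>v<n. c v) - \<phi> r"
  using sum_kids[of \<phi>] by (simp add: sum.distrib sum_subtractf)

text \<open>The balances sum to the total of \<open>c\<close> minus the root charge, so a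
  nonpositive total leaves room only for equalities. This turns a multiplicity bound into
  information on single vertices.\<close>

lemma discharge_tight:
  fixes c \<phi> :: "nat \<Rightarrow> int"
  assumes "\<forall>v<n. c v - \<phi> v + (\<Sum>u\<in>kids v. \<phi> u) \<ge> 0" and "\<phi> r \<ge> 0"
    and "(\<Sum>v<n. c v) \<le> 0"
  shows "\<And>v. v < n \<Longrightarrow> c v - \<phi> v + (\<Sum>u\<in>kids v. \<phi> u) = 0" and "\<phi> r = 0" and "(\<Sum>v<n. c v) = 0"
proof -
  have "(\<Sum>v<n. c v - \<phi> v + (\<Sum>u\<in>kids v. \<phi> u)) \<ge> 0" using assms(1) by (intro sum_nonneg) auto
  then have *: "(\<Sum>v<n. c v - \<phi> v + (\<Sum>u\<in>kids v. \<phi> u)) = 0" "\<phi> r = 0" "(\<Sum>v<n. c v) = 0"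
    using assms(2,3) discharge_sum[of c \<phi>] by linarith+
  show "c v - \<phi> v + (\<Sum>u\<in>kids v. \<phi> u) = 0" if "v < n" for v
    using *(1) assms(1) that by (subst (asm) sum_nonneg_eq_0_iff) auto
  show "\<phi> r = 0" "(\<Sum>v<n. c v) = 0" using * by auto
qed

lemma descend:
  assumes "P r" "\<And>u v. v < n \<Longrightarrow> u \<in> kids v \<Longrightarrow> P v \<Longrightarrow> P u" "v < n"
  shows "P v"
  using assms(3)
proof (induction "depth v" arbitrary: v)
  case 0
  then show ?case using depth_eq_0 assms(1) by simp
next
  case (Suc d)
  then have "v \<noteq> r" by auto
  then have "par v < n" "v \<in> kids (par v)" "d = depth (par v)"
    using Suc par_less depth_par by (auto simp: kids_iff)
  then show ?case using Suc assms(2) by blast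
qed

text \<open>The contributions of the kids vanish at x, leaving x minus the diagonal entry. Leaves
  are covered vacuously.\<close>

lemma val_all_kids_poles:
  assumes "v < n" "\<And>u. u \<in> kids v \<Longrightarrow> ord x u = -1"
  shows "ord x v \<noteq> -1" "ord x v = 1 \<longleftrightarrow> A $$ (v, v) = x"
proof -
  show np: "ord x v \<noteq> -1" using ord_pole_iff[OF assms(1)] assms(2) by fastforce
  have "val x v = x - A $$ (v, v)" using val_eq[OF assms(1) np] assms(2) by simp
  then show "ord x v = 1 \<longleftrightarrow> A $$ (v, v) = x" using ord_root_iff[OF assms(1)] np by auto
qed

lemma leaf_ord:
  assumes "v < n" "h v = 0"
  shows "ord x v \<noteq> -1" "ord x v = 1 \<longleftrightarrow> A $$ (v, v) = x"
  using val_all_kids_poles[OF assms(1)] kids_empty_iff assms by auto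

lemma ord_bounds: "v < n \<Longrightarrow> ord x v \<in> {-1, 0, 1}"
  using ord_cases by blast

lemma card_le_sum_kids:
  fixes \<phi> :: "nat \<Rightarrow> int"
  assumes "\<And>u. u \<in> kids v \<Longrightarrow> \<phi> u \<ge> 1"
  shows "int (card (kids v)) \<le> (\<Sum>u\<in>kids v. \<phi> u)"
  using sum_mono[of "kids v" "\<lambda>_. 1" \<phi>] assms by simp

lemma member_le_sum_kids:
  fixes \<phi> :: "nat \<Rightarrow> int"
  assumes "\<And>u. u \<in> kids v \<Longrightarrow> \<phi> u \<ge> 0" "u \<in> kids v"
  shows "\<phi> u \<le> (\<Sum>u\<in>kids v. \<phi> u)"
  using assms by (intro member_le_sum) auto

lemma kids_nonempty: "v < n \<Longrightarrow> h v > 0 \<Longrightarrow> \<exists>u. u \<in> kids v"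
  using kids_empty_iff by fastforce

text \<open>Each zero pays 1 to its parent, which covers every pole. A vertex of height
  \<open>Suc i\<close> is paid by all its kids but needs only one unit; these surpluses add up to
  the difference of the two level sizes.\<close>

lemma mult_ge_ell:
  assumes "i < H" and roots: "\<And>v. v < n \<Longrightarrow> h v = i \<Longrightarrow> ord x v = 1"
  shows "mult x A \<ge> ell n r par (Suc i)"
proof -
  define z :: "nat \<Rightarrow> int" where "z v = of_bool (ord x v = 1)" for v
  have "(\<Sum>v<n. (\<Sum>u\<in>kids v. of_bool (h u = i)) - of_bool (h v = Suc i))
      \<le> (\<Sum>v<n. ord x v - z v + (\<Sum>u\<in>kids v. z u))"
  proof (rule sum_mono)
    fix v assume "v \<in> {..<n}"
    then have v: "v < n" by simp
    have znn: "z u \<ge> 0" for u by (simp add: z_def)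
    show "(\<Sum>u\<in>kids v. of_bool (h u = i)) - of_bool (h v = Suc i) \<le> ord x v - z v + (\<Sum>u\<in>kids v. z u)"
    proof (cases "h v = Suc i")
      case True
      then obtain u where u: "u \<in> kids v" using kids_nonempty[OF v] by auto
      have kid: "ord x u = 1" if "u \<in> kids v" for u
        using roots h_kid[OF that] True that by (auto simp: kids_iff)
      then have "ord x v = -1" using ord_pole_iff[OF v] u by blast
      moreover have "int (card (kids v)) \<le> (\<Sum>u\<in>kids v. z u)"
        using kid by (intro card_le_sum_kids) (simp add: z_def)
      ultimately show ?thesis using True by (simp add: sum_kids_of_height z_def)
    next
      case False
      have "0 \<le> ord x v - z v + (\<Sum>u\<in>kids v. z u)"
      proof (cases "ord x v = -1")
        case True
        then obtain u where "u \<in> kids v" "z u = 1" using ord_pole_iff[OF v] by (auto simp: z_def)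
        then show ?thesis using member_le_sum_kids[of v z u] True znn by (simp add: z_def)
      next
        case False
        then have "ord x v - z v \<ge> 0" using ord_bounds[OF v, of x] by (auto simp: z_def)
        then show ?thesis using sum_nonneg[of "kids v" z] znn by simp
      qed
      then show ?thesis using False by (simp add: sum_kids_of_height)
    qed
  qed
  also have "\<dots> = int (mult x A) - z r"
    unfolding discharge_sum mult_eq_sum_ord ..
  also have "\<dots> \<le> int (mult x A)" by (simp add: z_def)
  finally show ?thesis
    using sum_kids_height[OF assms(1)] by (simp add: sum_subtractf ell_def flip: card_Vlev_eq)
qed

section \<open>The two values of alternating type\<close>

text \<open>The number of leaves bounds both multiplicities together: at a leaf only one value can
  vanish, and a higher vertex has positive total order only if neither value is a pole there, so
  that all its kids are zeros of neither. \<open>\<phi>\<close> marks vertices that are zeros of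
  neither value; at least two marked kids pay for up to two zeros.\<close>

lemma alternating_states:
  assumes "a1 \<noteq> a2" and dense: "int (mult a1 A) + int (mult a2 A) \<ge> int (card (Vlev n r par 0))"
  shows "\<exists>x y. {x, y} = {a1, a2} \<and>
    (\<forall>v<n. ord (if even (h v) then x else y) v = 1 \<and>
       (h v \<ge> 1 \<longrightarrow> ord (if even (h v) then y else x) v = -1))"
    and "int (mult a1 A) + int (mult a2 A) = int (card (Vlev n r par 0))"
proof -
  define \<phi> :: "nat \<Rightarrow> int" where "\<phi> v = of_bool (ord a1 v \<noteq> 1 \<and> ord a2 v \<noteq> 1)" for v
  define c :: "nat \<Rightarrow> int" where "c v = of_bool (h v = 0) - ord a1 v - ord a2 v" for v
  have phi_nonneg: "\<phi> v \<ge> 0" for v by (simp add: \<phi>_def)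
  have no_pole: "(\<Sum>u\<in>kids v. \<phi> u) \<ge> int (card (kids v))" if "v < n" "ord a1 v \<noteq> -1" "ord a2 v \<noteq> -1" for v
    using that ord_pole_iff by (intro card_le_sum_kids) (auto simp: \<phi>_def)
  have sum_c: "(\<Sum>v<n. c v) = int (card (Vlev n r par 0)) - int (mult a1 A) - int (mult a2 A)"
    by (simp add: c_def sum_subtractf card_Vlev_eq mult_eq_sum_ord)
  have e_nonneg: "c v - \<phi> v + (\<Sum>u\<in>kids v. \<phi> u) \<ge> 0" if v: "v < n" for v
  proof (cases "h v = 0")
    case True
    then have "kids v = {}" using kids_empty_iff[OF v] by simp
    then show ?thesis
      using leaf_ord[OF v True, of a1] leaf_ord[OF v True, of a2] assms(1)
        ord_bounds[OF v, of a1] ord_bounds[OF v, of a2] True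
      by (auto simp: c_def \<phi>_def)
  next
    case False
    have nn: "(\<Sum>u\<in>kids v. \<phi> u) \<ge> 0" using phi_nonneg by (intro sum_nonneg)
    show ?thesis
    proof (cases "ord a1 v \<noteq> -1 \<and> ord a2 v \<noteq> -1")
      case True
      then have "(\<Sum>u\<in>kids v. \<phi> u) \<ge> 2" using no_pole[OF v] card_kids_bound[OF v] False by simp
      then show ?thesis using ord_bounds[OF v, of a1] ord_bounds[OF v, of a2] False
        by (auto simp: c_def \<phi>_def)
    next
      case False
      then show ?thesis using nn ord_bounds[OF v, of a1] ord_bounds[OF v, of a2]
        by (auto simp: c_def \<phi>_def)
    qed
  qed
  then have "\<forall>v<n. c v - \<phi> v + (\<Sum>u\<in>kids v. \<phi> u) \<ge> 0" by blast
  moreover have "(\<Sum>v<n. c v) \<le> 0" using dense by (simp add: sum_c)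
  ultimately have tight: "\<And>v. v < n \<Longrightarrow> c v - \<phi> v + (\<Sum>u\<in>kids v. \<phi> u) = 0" "\<phi> r = 0" "(\<Sum>v<n. c v) = 0"
    using discharge_tight[of c \<phi>] phi_nonneg by blast+
  show "int (mult a1 A) + int (mult a2 A) = int (card (Vlev n r par 0))"
    using tight(3) sum_c by simp
  have kid_phi: "\<phi> u = 0" if v: "v < n" and "c v = 0" "\<phi> v = 0" "u \<in> kids v" for u v
  proof -
    have "(\<Sum>u\<in>kids v. \<phi> u) = 0" using tight(1)[OF v] that by simp
    then show ?thesis using member_le_sum_kids[of v \<phi> u] that phi_nonneg[of u] phi_nonneg by simp
  qed
  \<comment> \<open>From height 2 on, three kids outnumber the two possible zeros, so tightness
    forces a pole. At height 1 two kids would balance a double zero, which must be excluded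
    separately.\<close>
  have split: "ord a1 v = -1 \<and> ord a2 v = 1 \<or> ord a1 v = 1 \<and> ord a2 v = -1"
    if v: "v < n" "h v \<ge> 1" "\<phi> v = 0" and "h v \<ge> 2 \<or> \<not> (ord a1 v = 1 \<and> ord a2 v = 1)" for v
  proof (rule ccontr)
    assume "\<not> ?thesis"
    then have np: "ord a1 v \<noteq> -1" "ord a2 v \<noteq> -1" using v(3) by (auto simp: \<phi>_def split: if_splits)
    have "int (card (kids v)) > ord a1 v + ord a2 v"
      using that(4) card_kids_bound[OF v(1,2)] card_kids_bound3[OF v(1)]
        ord_bounds[OF v(1), of a1] ord_bounds[OF v(1), of a2] by auto
    then show False
      using no_pole[OF v(1) np] tight(1)[OF v(1)] v by (simp add: c_def)
  qed
  \<comment> \<open>\<open>x\<close> is to be the value that vanishes on even heights; the state of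
    the root and the parity of \<open>H\<close> decide which one that is.\<close>
  obtain x y where xy: "{x, y} = {a1, a2}" "ord (if even H then x else y) r = 1" "ord (if even H then y else x) r = -1"
  proof -
    have "ord a1 r = -1 \<and> ord a2 r = 1 \<or> ord a1 r = 1 \<and> ord a2 r = -1"
      using split[OF root_less] tight(2) height_ge_2 by simp
    then show ?thesis
      using that[of a1 a2] that[of a2 a1] by (cases "even H") (auto simp: insert_commute)
  qed
  have sym: "ord a1 v + ord a2 v = ord x v + ord y v"
    "\<phi> v = of_bool (ord x v \<noteq> 1 \<and> ord y v \<noteq> 1)" for v
    using xy(1) by (auto simp: doubleton_eq_iff \<phi>_def)
  define Q where "Q v \<longleftrightarrow> ord (if even (h v) then x else y) v = 1 \<and>
       (h v \<ge> 1 \<longrightarrow> ord (if even (h v) then y else x) v = -1)" for v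
  have "Q v \<and> \<phi> v = 0" if "v < n" for v
  proof (rule descend[of "\<lambda>v. Q v \<and> \<phi> v = 0"])
    show "Q r \<and> \<phi> r = 0" using xy tight(2) by (simp add: Q_def)
    fix u v assume v: "v < n" and u: "u \<in> kids v" and Qv: "Q v \<and> \<phi> v = 0"
    have hv: "h v = Suc (h u)" and un: "u < n" using h_kid[OF u] u by (auto simp: kids_iff)
    have "ord x v + ord y v = 0" using Qv hv by (auto simp: Q_def split: if_splits)
    then have "ord a1 v + ord a2 v = 0" using sym by simp
    then have "c v = 0" using hv by (simp add: c_def)
    then have \<phi>u: "\<phi> u = 0" using kid_phi v u Qv by blast
    \<comment> \<open>The parent is a zero for this value, hence no pole, so no kid vanishes there.
      This also rules out the double zero at height 1.\<close>
    have other: "ord (if even (h u) then y else x) u \<noteq> 1"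
    proof
      assume "ord (if even (h u) then y else x) u = 1"
      then have "ord (if even (h u) then y else x) v = -1" using ord_pole_iff[OF v] u by blast
      then show False using Qv hv by (auto simp: Q_def split: if_splits)
    qed
    then have root: "ord (if even (h u) then x else y) u = 1" using \<phi>u sym by (auto split: if_splits)
    have "ord (if even (h u) then y else x) u = -1" if "h u \<ge> 1"
    proof -
      have "\<not> (ord a1 u = 1 \<and> ord a2 u = 1)"
        using other xy(1) by (auto simp: doubleton_eq_iff split: if_splits)
      then show ?thesis
        using split[OF un that \<phi>u] other root xy(1) by (auto simp: doubleton_eq_iff split: if_splits)
    qed
    then show "Q u \<and> \<phi> u = 0" using root \<phi>u by (simp add: Q_def)
  qed (rule that)
  then show "\<exists>x y. {x, y} = {a1, a2} \<and>
    (\<forall>v<n. ord (if even (h v) then x else y) v = 1 \<and>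
       (h v \<ge> 1 \<longrightarrow> ord (if even (h v) then y else x) v = -1))"
    using xy(1) by (intro exI[of _ x] exI[of _ y]) (simp add: Q_def)
qed

lemma sum_ell_from:
  "(\<Sum>i | 1 \<le> i \<and> i \<le> H + 1 \<and> j < i. int (ell n r par i)) = int (card (Vlev n r par j))"
proof -
  have "(\<Sum>i | 1 \<le> i \<and> i \<le> H + 1 \<and> j < i. int (ell n r par i))
      = (\<Sum>v<n. of_bool (j < Suc (h v)) - of_bool (j < h v))"
    by (rule sum_ell) simp
  also have "\<dots> = (\<Sum>v<n. of_bool (h v = j))"
    by (rule sum.cong) auto
  finally show ?thesis by (simp add: card_Vlev_eq)
qed

lemma sum_ell_parity:
  "(\<Sum>i | 1 \<le> i \<and> i \<le> H + 1 \<and> odd i. int (ell n r par i)) +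
   (\<Sum>i | 1 \<le> i \<and> i \<le> H + 1 \<and> even i. int (ell n r par i)) = int (card (Vlev n r par 0))"
proof -
  have "int (card (Vlev n r par 0)) = (\<Sum>i | 1 \<le> i \<and> i \<le> H + 1 \<and> 0 < i. int (ell n r par i))"
    by (rule sum_ell_from[symmetric])
  also have "{i. 1 \<le> i \<and> i \<le> H + 1 \<and> 0 < i} =
     {i. 1 \<le> i \<and> i \<le> H + 1 \<and> odd i} \<union> {i. 1 \<le> i \<and> i \<le> H + 1 \<and> even i}" by auto
  finally show ?thesis by (subst (asm) sum.union_disjoint) auto
qed

text \<open>Even indices together with 3 all exceed 1, so their sum is at most |V_1|, and two kids
  at height 1 give |V_1| \<le> l_1. Strictness comes from l_3 > 0.\<close>

lemma sum_even_ell_less: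
  "(\<Sum>i | 1 \<le> i \<and> i \<le> H + 1 \<and> even i. int (ell n r par i)) < int (ell n r par 1)"
proof -
  let ?E = "{i. 1 \<le> i \<and> i \<le> H + 1 \<and> even i}"
  have "(\<Sum>i\<in>?E. int (ell n r par i)) + int (ell n r par 3) = (\<Sum>i\<in>insert 3 ?E. int (ell n r par i))"
    by (subst sum.insert) auto
  also have "\<dots> \<le> (\<Sum>i | 1 \<le> i \<and> i \<le> H + 1 \<and> 1 < i. int (ell n r par i))"
  proof (intro sum_mono2)
    have "1 < i" if "even i" "1 \<le> i" for i :: nat using that by presburger
    then show "insert 3 ?E \<subseteq> {i. 1 \<le> i \<and> i \<le> H + 1 \<and> 1 < i}" using height_ge_2 by auto
  qed auto
  also have "\<dots> = int (card (Vlev n r par 1))" by (rule sum_ell_from)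
  also have "\<dots> \<le> int (ell n r par 1)"
    using card_Vlev_Suc[of 0] height_ge_2 by (simp add: ell_def)
  finally show ?thesis using ell_pos[of 2] height_ge_2 by (simp add: numeral_3_eq_3 numeral_2_eq_2)
qed

text \<open>If \<open>a2\<close> vanished on the leaves, \<open>mult_ge_ell\<close> would give it
  multiplicity at least l_1, more than the even-index sum that equality in the joint count leaves
  for it.\<close>

lemma alternating_orientation:
  assumes "a1 \<noteq> a2"
    and m1: "int (mult a1 A) \<ge> (\<Sum>i | 1 \<le> i \<and> i \<le> H + 1 \<and> odd i. int (ell n r par i))"
    and m2: "int (mult a2 A) \<ge> (\<Sum>i | 1 \<le> i \<and> i \<le> H + 1 \<and> even i. int (ell n r par i))"
  shows "\<forall>v<n. ord (if even (h v) then a1 else a2) v = 1 \<and>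
       (h v \<ge> 1 \<longrightarrow> ord (if even (h v) then a2 else a1) v = -1)"
    and "int (mult a1 A) = (\<Sum>i | 1 \<le> i \<and> i \<le> H + 1 \<and> odd i. int (ell n r par i))"
    and "int (mult a2 A) = (\<Sum>i | 1 \<le> i \<and> i \<le> H + 1 \<and> even i. int (ell n r par i))"
proof -
  have "int (mult a1 A) + int (mult a2 A) \<ge> int (card (Vlev n r par 0))"
    using m1 m2 sum_ell_parity by linarith
  note alt = alternating_states[OF assms(1) this]
  show eq1: "int (mult a1 A) = (\<Sum>i | 1 \<le> i \<and> i \<le> H + 1 \<and> odd i. int (ell n r par i))"
    and eq2: "int (mult a2 A) = (\<Sum>i | 1 \<le> i \<and> i \<le> H + 1 \<and> even i. int (ell n r par i))"
    using m1 m2 alt(2) sum_ell_parity by linarith+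
  obtain x y where xy: "{x, y} = {a1, a2}"
    and st: "\<forall>v<n. ord (if even (h v) then x else y) v = 1 \<and>
       (h v \<ge> 1 \<longrightarrow> ord (if even (h v) then y else x) v = -1)"
    using alt(1) by blast
  have "x \<noteq> a2"
  proof
    assume "x = a2"
    then have "mult a2 A \<ge> ell n r par (Suc 0)"
    proof (intro mult_ge_ell)
      fix v assume "v < n" "h v = 0"
      then show "ord a2 v = 1" using st[rule_format, of v] \<open>x = a2\<close> by simp
    qed (use height_ge_2 in simp)
    then show False using eq2 sum_even_ell_less by simp
  qed
  then have "x = a1" "y = a2" using xy assms(1) by (auto simp: doubleton_eq_iff)
  then show "\<forall>v<n. ord (if even (h v) then a1 else a2) v = 1 \<and>
       (h v \<ge> 1 \<longrightarrow> ord (if even (h v) then a2 else a1) v = -1)"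
    using st by (simp only:)
qed

section \<open>The values of period three\<close>

text \<open>The orders expected of beta_(s+1), whose first zeros are at height s; the shift is that
  of l_i, which counts level i - 1 positively.\<close>

definition period3 :: "nat \<Rightarrow> nat \<Rightarrow> int" where
  "period3 s k = (if k < s then 0 else if (k - s) mod 3 = 0 then 1 else if (k - s) mod 3 = 1 then -1 else 0)"

lemma sum_period3:
  "(\<Sum>v<n. period3 s (h v)) =
   (\<Sum>i | 1 \<le> i \<and> i \<le> H + 1 \<and> s < i \<and> i mod 3 = Suc s mod 3. int (ell n r par i))"
proof -
  have "period3 s k = of_bool (s < Suc k \<and> Suc k mod 3 = Suc s mod 3) - of_bool (s < k \<and> k mod 3 = Suc s mod 3)" for k
  proof (cases "k < s")
    case False
    then obtain d where k: "k = s + d" by (metis le_add_diff_inverse not_less)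
    have "s mod 3 = 0 \<or> s mod 3 = 1 \<or> s mod 3 = 2" "d mod 3 = 0 \<or> d mod 3 = 1 \<or> d mod 3 = 2" by linarith+
    then have "(s mod 3 + d mod 3) mod 3 = Suc (s mod 3) mod 3 \<longleftrightarrow> d mod 3 = 1"
      "Suc (s mod 3 + d mod 3) mod 3 = Suc (s mod 3) mod 3 \<longleftrightarrow> d mod 3 = 0"
      by (elim disjE; simp)+
    then have "(s + d) mod 3 = Suc s mod 3 \<longleftrightarrow> d mod 3 = 1" "Suc (s + d) mod 3 = Suc s mod 3 \<longleftrightarrow> d mod 3 = 0"
      by (metis mod_add_eq mod_Suc_eq)+
    moreover have "0 < d" if "d mod 3 = 1" using that by (cases "d = 0") simp_all
    ultimately show ?thesis unfolding period3_def k by (cases "d mod 3 = 0"; cases "d mod 3 = 1") simp_all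
  qed (simp add: period3_def)
  then have "(\<Sum>v<n. period3 s (h v)) = (\<Sum>v<n. of_bool (s < Suc (h v) \<and> Suc (h v) mod 3 = Suc s mod 3)
      - of_bool (s < h v \<and> h v mod 3 = Suc s mod 3))" by (simp only:)
  also have "\<dots> = (\<Sum>i | 1 \<le> i \<and> i \<le> H + 1 \<and> s < i \<and> i mod 3 = Suc s mod 3. int (ell n r par i))"
    by (rule sum_ell[symmetric]) simp
  finally show ?thesis .
qed

text \<open>By \<open>diag\<close>, a zero above height s needs a kid of order 0: zeros and poles
  cannot alternate there, and period three is the densest possible pattern.\<close>

lemma period3_states:
  assumes diag: "\<And>v. v < n \<Longrightarrow> h v \<noteq> 1 \<Longrightarrow> A $$ (v, v) \<noteq> x"
    and s: "s \<ge> 1"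
    and low: "\<And>v. v < n \<Longrightarrow> h v < s \<Longrightarrow> ord x v = 0"
    and dense: "int (mult x A) \<ge>
      (\<Sum>i | 1 \<le> i \<and> i \<le> H + 1 \<and> s < i \<and> i mod 3 = Suc s mod 3. int (ell n r par i))"
    and v: "v < n"
  shows "ord x v = period3 s (h v)"
proof -
  \<comment> \<open>Charge in phase p of the period; 0 exactly for the expected order. Above height
    s the kids have to supply 1 for a misplaced pole (some kid is a zero), 3 for a missing pole in
    phase 1 (three kids, none a zero), and 2 for a zero in phase 2 (some kid has order 0). The
    numbers are fitted to these three payments.\<close>
  define w :: "nat \<Rightarrow> int \<Rightarrow> int" where
    "w p o' = (if p = 0 then (if o' = 1 then 0 else if o' = 0 then 1 else 3)
      else if p = 1 then (if o' = -1 then 0 else if o' = 1 then 1 else 2)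
      else (if o' = 0 then 0 else if o' = 1 then 1 else 2))" for p o'
  define \<phi> where "\<phi> v = (if h v < s then 0 else w ((h v - s) mod 3) (ord x v))" for v
  define c where "c v = period3 s (h v) - ord x v" for v
  have phi_nonneg: "\<phi> v \<ge> 0" for v by (simp add: \<phi>_def w_def)
  have sum_nn: "(\<Sum>u\<in>kids v. \<phi> u) \<ge> 0" for v using phi_nonneg by (intro sum_nonneg)
  have phi0: "ord x v = period3 s (h v)" if "v < n" "\<phi> v = 0" for v
    using that low ord_bounds[OF that(1), of x] by (auto simp: \<phi>_def w_def period3_def split: if_splits)
  have e_nonneg: "c v - \<phi> v + (\<Sum>u\<in>kids v. \<phi> u) \<ge> 0" if v: "v < n" for v
  proof (cases "h v \<le> s")
    case True
    have kz: "ord x u = 0" if "u \<in> kids v" for u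
      using low h_kid[OF that] that True by (auto simp: kids_iff)
    then have "ord x v \<noteq> -1" using ord_pole_iff[OF v] by fastforce
    then have "c v - \<phi> v \<ge> 0"
      using True ord_bounds[OF v, of x] low[OF v] by (auto simp: c_def \<phi>_def w_def period3_def)
    then show ?thesis using sum_nn[of v] by simp
  next
    case False
    then obtain d where d: "h v = Suc (s + d)" using less_imp_Suc_add[of s "h v"] by auto
    have hk: "h u = s + d" if "u \<in> kids v" for u using h_kid[OF that] d by simp
    have \<phi>k: "\<phi> u = w (d mod 3) (ord x u)" if "u \<in> kids v" for u
      using hk[OF that] by (simp add: \<phi>_def)
    have per: "period3 s (h v) = (if Suc d mod 3 = 0 then 1 else if Suc d mod 3 = 1 then -1 else 0)"
      "\<phi> v = w (Suc d mod 3) (ord x v)"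
      by (simp_all add: period3_def \<phi>_def d)
    have pole: "ord x v = -1 \<Longrightarrow> \<exists>u\<in>kids v. ord x u = 1" and nopole: "ord x v \<noteq> -1 \<Longrightarrow> \<forall>u\<in>kids v. ord x u \<noteq> 1"
      using ord_pole_iff[OF v] by blast+
    have root: "\<exists>u\<in>kids v. ord x u = 0" if "ord x v = 1"
    proof (rule ccontr)
      assume neg: "\<not> ?thesis"
      have "ord x u = -1" if "u \<in> kids v" for u
        using neg nopole \<open>ord x v = 1\<close> that ord_bounds[of u x] kids_subset[of v] by auto
      then have "A $$ (v, v) = x" using val_all_kids_poles[OF v] that by blast
      then show False using diag[OF v] d s by simp
    qed
    have card3: "int (card (kids v)) \<ge> 3" using card_kids_bound3[OF v] d s by simp
    have ge_kid: "\<phi> u \<le> (\<Sum>u\<in>kids v. \<phi> u)" if "u \<in> kids v" for u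
      using member_le_sum_kids[of v \<phi>] phi_nonneg that by blast
    consider "d mod 3 = 2" | "d mod 3 = 0" | "d mod 3 = 1" by linarith
    then show ?thesis
    proof cases
      case 1
      then have "Suc d mod 3 = 0" by presburger
      then have cv: "c v - \<phi> v = (if ord x v = -1 then -1 else 0)"
        using per ord_bounds[OF v, of x] by (auto simp: c_def w_def)
      show ?thesis
      proof (cases "ord x v = -1")
        case True
        then obtain u where "u \<in> kids v" "ord x u = 1" using pole by blast
        then have "\<phi> u = 1" using \<phi>k 1 by (simp add: w_def)
        then show ?thesis using ge_kid[OF \<open>u \<in> kids v\<close>] cv by simp
      qed (use cv sum_nn[of v] in simp)
    next
      case 2
      then have "Suc d mod 3 = 1" by presburger
      then have cv: "c v - \<phi> v \<ge> (if ord x v = -1 then 0 else -3)"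
        using per ord_bounds[OF v, of x] by (auto simp: c_def w_def)
      show ?thesis
      proof (cases "ord x v = -1")
        case False
        have "int (card (kids v)) \<le> (\<Sum>u\<in>kids v. \<phi> u)"
          using nopole[OF False] \<phi>k 2 by (intro card_le_sum_kids) (simp add: w_def)
        then show ?thesis using cv card3 False by simp
      qed (use cv sum_nn[of v] in simp)
    next
      case 3
      then have "Suc d mod 3 = 2" by presburger
      then have cv: "c v - \<phi> v = (if ord x v = -1 then -1 else if ord x v = 1 then -2 else 0)"
        using per ord_bounds[OF v, of x] by (auto simp: c_def w_def)
      consider "ord x v = -1" | "ord x v = 0" | "ord x v = 1" using ord_bounds[OF v, of x] by blast
      then show ?thesis
      proof cases
        case a: 1
        then obtain u where "u \<in> kids v" "ord x u = 1" using pole by blast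
        then have "\<phi> u = 1" using \<phi>k 3 by (simp add: w_def)
        then show ?thesis using ge_kid[OF \<open>u \<in> kids v\<close>] cv a by simp
      next
        case 2
        then show ?thesis using cv sum_nn[of v] by simp
      next
        case a: 3
        then obtain u where "u \<in> kids v" "ord x u = 0" using root by blast
        then have "\<phi> u = 2" using \<phi>k 3 by (simp add: w_def)
        then show ?thesis using ge_kid[OF \<open>u \<in> kids v\<close>] cv a by simp
      qed
    qed
  qed
  have "(\<Sum>v<n. c v) \<le> 0"
    using dense by (simp add: c_def sum_subtractf sum_period3 mult_eq_sum_ord)
  then have tight: "\<And>v. v < n \<Longrightarrow> c v - \<phi> v + (\<Sum>u\<in>kids v. \<phi> u) = 0" "\<phi> r = 0"
    using discharge_tight[of c \<phi>] phi_nonneg e_nonneg by blast+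
  have "\<phi> v = 0"
  proof (rule descend[of "\<lambda>v. \<phi> v = 0"])
    fix u v assume uv: "v < n" "u \<in> kids v" "\<phi> v = 0"
    then have "c v = 0" using phi0 by (simp add: c_def)
    then have "(\<Sum>u\<in>kids v. \<phi> u) = 0" using tight(1)[OF uv(1)] uv(3) by simp
    then show "\<phi> u = 0" using member_le_sum_kids[of v \<phi> u] phi_nonneg[of u] phi_nonneg uv(2) by simp
  qed (use tight(2) v in auto)
  then show ?thesis using phi0 v by blast
qed

section \<open>The entries of the matrix\<close>

abbreviation down_weight :: "nat \<Rightarrow> real" where
  "down_weight v \<equiv> \<Sum>u\<in>kids v. A $$ (v, u) * A $$ (u, v)"

lemma down_weight_pos:
  assumes "v < n" "h v \<ge> 1"
  shows "down_weight v > 0"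
proof -
  have "kids v \<noteq> {}" using kids_empty_iff assms by simp
  then show ?thesis using wt_pos by (intro sum_pos) auto
qed

lemma val_uniform:
  assumes "v < n" "\<And>u. u \<in> kids v \<Longrightarrow> ord x u = 0" "\<And>u. u \<in> kids v \<Longrightarrow> val x u = c"
  shows "ord x v \<noteq> -1" "val x v = x - A $$ (v, v) - down_weight v / c"
proof -
  show np: "ord x v \<noteq> -1" using ord_pole_iff[OF assms(1)] assms(2) by fastforce
  have "(\<Sum>u\<in>kids v. if ord x u = 0 then wt v u / val x u else 0) = down_weight v / c"
    unfolding sum_divide_distrib using assms by (intro sum.cong) auto
  then show "val x v = x - A $$ (v, v) - down_weight v / c" using val_eq[OF assms(1) np] by simp
qed

lemma down_weight_of_root:
  assumes "v < n" "\<And>u. u \<in> kids v \<Longrightarrow> ord x u = 0" "\<And>u. u \<in> kids v \<Longrightarrow> val x u = c"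
    and "c \<noteq> 0" "ord x v = 1"
  shows "down_weight v = (x - A $$ (v, v)) * c"
proof -
  have "val x v = 0" using ord_root_iff[OF assms(1)] assms(5) by simp
  then show ?thesis using val_uniform(2)[OF assms(1-3)] assms(4) by (simp add: field_simps)
qed

lemma leaf_val:
  assumes "v < n" "h v = 0"
  shows "val x v = x - A $$ (v, v)"
proof -
  have "kids v = {}" using kids_empty_iff assms by simp
  then show ?thesis using val_uniform(2)[OF assms(1), of x 0] by simp
qed

end

section \<open>Critical lists: orders and entries level by level\<close>

locale critical_hedge = lush_hedge +
  fixes a1 a2 b2 b3 b4 :: real
  assumes critical: "crit_witness n r par A a1 a2 b2 b3 b4"
begin

lemma distinct: "distinct [a1, a2, b2, b3, b4]"
  and mult_b4_less: "mult b4 A < ell n r par 3"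
  using critical by (simp_all add: crit_witness_def Let_def)

lemma mult_bounds:
  "(\<Sum>i | 1 \<le> i \<and> i \<le> H + 1 \<and> i mod 2 = 1 mod 2. ell n r par i) \<le> mult a1 A"
  "(\<Sum>i | 2 \<le> i \<and> i \<le> H + 1 \<and> i mod 2 = 2 mod 2. ell n r par i) \<le> mult a2 A"
  "(\<Sum>i | 2 \<le> i \<and> i \<le> H + 1 \<and> i mod 3 = 2 mod 3. ell n r par i) \<le> mult b2 A"
  "(\<Sum>i | 3 \<le> i \<and> i \<le> H + 1 \<and> i mod 3 = 3 mod 3. ell n r par i) \<le> mult b3 A"
  "(\<Sum>i | 4 \<le> i \<and> i \<le> H + 1 \<and> i mod 3 = 4 mod 3. ell n r par i) \<le> mult b4 A"
  using critical unfolding crit_witness_def Let_def by blast+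

lemma mult_a1: "(\<Sum>i | 1 \<le> i \<and> i \<le> H + 1 \<and> odd i. int (ell n r par i)) \<le> int (mult a1 A)"
proof -
  have "{i. 1 \<le> i \<and> i \<le> H + 1 \<and> i mod 2 = 1 mod 2} = {i. 1 \<le> i \<and> i \<le> H + 1 \<and> odd i}"
    by (auto simp: odd_iff_mod_2_eq_one)
  then show ?thesis using mult_bounds(1) by (simp only: of_nat_le_iff flip: of_nat_sum)
qed

lemma mult_a2: "(\<Sum>i | 1 \<le> i \<and> i \<le> H + 1 \<and> even i. int (ell n r par i)) \<le> int (mult a2 A)"
proof -
  have "2 \<le> i \<and> i \<le> H + 1 \<and> i mod 2 = 2 mod 2 \<longleftrightarrow> 1 \<le> i \<and> i \<le> H + 1 \<and> even i" for i
    by presburger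
  then have "{i. 2 \<le> i \<and> i \<le> H + 1 \<and> i mod 2 = 2 mod 2} = {i. 1 \<le> i \<and> i \<le> H + 1 \<and> even i}"
    by (simp only:)
  then show ?thesis using mult_bounds(2) by (simp only: of_nat_le_iff flip: of_nat_sum)
qed

lemma mult_b:
  "(\<Sum>i | 1 \<le> i \<and> i \<le> H + 1 \<and> 1 < i \<and> i mod 3 = Suc 1 mod 3. int (ell n r par i)) \<le> int (mult b2 A)"
  "(\<Sum>i | 1 \<le> i \<and> i \<le> H + 1 \<and> 2 < i \<and> i mod 3 = Suc 2 mod 3. int (ell n r par i)) \<le> int (mult b3 A)"
  "(\<Sum>i | 1 \<le> i \<and> i \<le> H + 1 \<and> 3 < i \<and> i mod 3 = Suc 3 mod 3. int (ell n r par i)) \<le> int (mult b4 A)"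
proof -
  have "{i. 2 \<le> i \<and> i \<le> H + 1 \<and> i mod 3 = 2 mod 3} = {i. 1 \<le> i \<and> i \<le> H + 1 \<and> 1 < i \<and> i mod 3 = Suc 1 mod 3}"
    "{i. 3 \<le> i \<and> i \<le> H + 1 \<and> i mod 3 = 3 mod 3} = {i. 1 \<le> i \<and> i \<le> H + 1 \<and> 2 < i \<and> i mod 3 = Suc 2 mod 3}"
    "{i. 4 \<le> i \<and> i \<le> H + 1 \<and> i mod 3 = 4 mod 3} = {i. 1 \<le> i \<and> i \<le> H + 1 \<and> 3 < i \<and> i mod 3 = Suc 3 mod 3}"
    by auto
  then show
  "(\<Sum>i | 1 \<le> i \<and> i \<le> H + 1 \<and> 1 < i \<and> i mod 3 = Suc 1 mod 3. int (ell n r par i)) \<le> int (mult b2 A)"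
  "(\<Sum>i | 1 \<le> i \<and> i \<le> H + 1 \<and> 2 < i \<and> i mod 3 = Suc 2 mod 3. int (ell n r par i)) \<le> int (mult b3 A)"
  "(\<Sum>i | 1 \<le> i \<and> i \<le> H + 1 \<and> 3 < i \<and> i mod 3 = Suc 3 mod 3. int (ell n r par i)) \<le> int (mult b4 A)"
    using mult_bounds(3-5) by (simp_all only: of_nat_le_iff flip: of_nat_sum)
qed

lemma mult_alpha_eq:
  "int (mult a1 A) = (\<Sum>i | 1 \<le> i \<and> i \<le> H + 1 \<and> odd i. int (ell n r par i))"
  "int (mult a2 A) = (\<Sum>i | 1 \<le> i \<and> i \<le> H + 1 \<and> even i. int (ell n r par i))"
  using alternating_orientation(2,3)[OF _ mult_a1 mult_a2] distinct by auto

lemma ord_alpha: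
  assumes "v < n"
  shows "ord (if even (h v) then a1 else a2) v = 1"
    and "h v \<ge> 1 \<Longrightarrow> ord (if even (h v) then a2 else a1) v = -1"
  using alternating_orientation(1)[OF _ mult_a1 mult_a2] distinct assms by auto

text \<open>Above height 1 the value vanishing at v has a pole at every kid, so f_v there is that
  value minus the diagonal entry. At height 1 this fails because leaves have no poles.\<close>

lemma diagonal:
  assumes v: "v < n" and "h v \<noteq> 1"
  shows "A $$ (v, v) = (if even (h v) then a1 else a2)"
proof (cases "h v = 0")
  case True
  then show ?thesis using leaf_ord(2)[OF v True, of a1] ord_alpha(1)[OF v] by simp
next
  case False
  have "ord (if even (h v) then a1 else a2) u = -1" if u: "u \<in> kids v" for u
  proof -
    have "u < n" "h v = Suc (h u)" using u h_kid by (auto simp: kids_iff)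
    then show ?thesis using ord_alpha(2)[of u] assms(2) False by (simp split: if_splits)
  qed
  then show ?thesis using val_all_kids_poles(2)[OF v] ord_alpha(1)[OF v] by blast
qed

lemma leaf_ord_val:
  assumes "v < n" "h v = 0" "x \<noteq> a1"
  shows "ord x v = 0" "val x v = x - a1"
proof -
  have "A $$ (v, v) = a1" using diagonal assms by simp
  then show "ord x v = 0" "val x v = x - a1"
    using leaf_ord[OF assms(1,2), of x] leaf_val[OF assms(1,2), of x] ord_bounds[OF assms(1), of x] assms(3)
    by auto
qed

lemma diagonal_neq:
  assumes "x \<noteq> a1" "x \<noteq> a2" "v < n" "h v \<noteq> 1"
  shows "A $$ (v, v) \<noteq> x"
  using diagonal assms by auto

lemma ord_b2:
  assumes "v < n"
  shows "ord b2 v = period3 1 (h v)"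
proof (rule period3_states)
  show "A $$ (v, v) \<noteq> b2" if "v < n" "h v \<noteq> 1" for v
    using diagonal_neq[of b2 v] that distinct by auto
qed (use distinct leaf_ord_val assms mult_b in auto)

text \<open>The kids have value x - a1, so f_v is a monic quadratic divided by x - a1. Its two roots
  are \<open>a2\<close> and \<open>b2\<close>, which determines both coefficients.\<close>

lemma level1:
  assumes v: "v < n" "h v = 1"
  shows "A $$ (v, v) = - a1 + a2 + b2" and "down_weight v = (b2 - a1) * (a1 - a2)"
    and "x \<noteq> a1 \<Longrightarrow> val x v = (x - a2) * (x - b2) / (x - a1)"
    and "x \<notin> {a1, a2, b2} \<Longrightarrow> ord x v = 0"
proof -
  have kid: "u < n" "h u = 0" if "u \<in> kids v" for u
    using h_kid[OF that] that v by (auto simp: kids_iff)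
  define d s where "d = A $$ (v, v)" and "s = down_weight v"
  have val: "ord x v \<noteq> -1" "val x v = x - d - s / (x - a1)" if "x \<noteq> a1" for x
    using val_uniform[OF v(1), of x "x - a1"] kid leaf_ord_val that by (auto simp: d_def s_def)
  have ne: "a1 \<noteq> a2" "a1 \<noteq> b2" "a2 \<noteq> b2" using distinct by auto
  have "val a2 v = 0" using ord_alpha(1)[OF v(1)] v ord_root_iff[OF v(1), of a2] by simp
  then have e1: "(a2 - d) * (a2 - a1) = s" using val(2)[of a2] ne by (simp add: field_simps)
  have "val b2 v = 0" using ord_b2[OF v(1)] v ord_root_iff[OF v(1), of b2] by (simp add: period3_def)
  then have e2: "(b2 - d) * (b2 - a1) = s" using val(2)[of b2] ne by (simp add: field_simps)
  have "(b2 - a2) * (d + a1 - a2 - b2) = 0" using e1 e2 by (simp add: algebra_simps)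
  then have d: "d = - a1 + a2 + b2" using ne by auto
  have s: "s = (b2 - a1) * (a1 - a2)" using e1 unfolding d by (simp add: algebra_simps)
  show "A $$ (v, v) = - a1 + a2 + b2" "down_weight v = (b2 - a1) * (a1 - a2)"
    using d s by (simp_all add: d_def s_def)
  have val': "val x v = (x - a2) * (x - b2) / (x - a1)" if "x \<noteq> a1" for x
    unfolding val(2)[OF that] d s using that by (simp add: divide_simps) (simp add: algebra_simps)
  then show "x \<noteq> a1 \<Longrightarrow> val x v = (x - a2) * (x - b2) / (x - a1)" .
  show "ord x v = 0" if "x \<notin> {a1, a2, b2}"
    using that val(1)[of x] val'[of x] ord_root_iff[OF v(1), of x] ord_bounds[OF v(1), of x] by auto
qed

lemma ord_b3:
  assumes "v < n"
  shows "ord b3 v = period3 2 (h v)"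
proof (rule period3_states)
  show "A $$ (v, v) \<noteq> b3" if "v < n" "h v \<noteq> 1" for v
    using diagonal_neq[of b3 v] that distinct by auto
  show "ord b3 v = 0" if "v < n" "h v < 2" for v
    using leaf_ord_val(1)[OF that(1)] level1(4)[OF that(1)] that distinct
    by (cases "h v = 0") auto
qed (use mult_b assms in auto)

text \<open>The numerator is x - a1 times the quadratic (x - a2)(x - b2) - (b3 - a2)(b3 - b2). One
  root of the latter is \<open>b3\<close>, so the other is a2 + b2 - b3.\<close>

lemma level2:
  assumes v: "v < n" "h v = 2"
  shows "down_weight v = (b3 - a2) * (b3 - b2)"
    and "x \<notin> {a1, a2, b2} \<Longrightarrow>
      val x v = (x - a1) * (x - b3) * (x + b3 - a2 - b2) / ((x - a2) * (x - b2))"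
    and "x \<notin> {a1, a2, b2} \<Longrightarrow> ord x v \<noteq> -1"
proof -
  have kid: "u < n" "h u = 1" if "u \<in> kids v" for u
    using h_kid[OF that] that v by (auto simp: kids_iff)
  have d: "A $$ (v, v) = a1" using diagonal v by simp
  have ne: "b3 \<notin> {a1, a2, b2}" using distinct by auto
  have "down_weight v = (b3 - A $$ (v, v)) * ((b3 - a2) * (b3 - b2) / (b3 - a1))"
    by (rule down_weight_of_root[OF v(1)]) (use kid level1(3,4) ne ord_b3[OF v(1)] v in \<open>auto simp: period3_def\<close>)
  then show s: "down_weight v = (b3 - a2) * (b3 - b2)" using d ne by simp
  assume x: "x \<notin> {a1, a2, b2}"
  note val = val_uniform[OF v(1), of x "(x - a2) * (x - b2) / (x - a1)"]
  show "ord x v \<noteq> -1" using val(1) kid level1(3,4) x by auto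
  have "val x v = x - a1 - (b3 - a2) * (b3 - b2) / ((x - a2) * (x - b2) / (x - a1))"
    using val(2) kid level1(3,4) x d s by auto
  also have "\<dots> = (x - a1) * (x - b3) * (x + b3 - a2 - b2) / ((x - a2) * (x - b2))"
    using x by (simp add: divide_simps) (simp add: algebra_simps)
  finally show "val x v = (x - a1) * (x - b3) * (x + b3 - a2 - b2) / ((x - a2) * (x - b2))" .
qed

text \<open>Otherwise \<open>b4\<close> would be the second root a2 + b2 - b3 found at height 2, a
  zero on that whole level, and \<open>mult_ge_ell\<close> would contradict
  \<open>mult_b4_less\<close>.\<close>

lemma sum_b_neq:
  assumes "H \<ge> 3"
  shows "b4 + b3 - a2 - b2 \<noteq> 0"
proof
  assume eq: "b4 + b3 - a2 - b2 = 0"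
  have "ord b4 v = 1" if "v < n" "h v = 2" for v
    using level2(2,3)[OF that, of b4] distinct eq ord_root_iff[OF that(1), of b4] by auto
  then have "ell n r par (Suc 2) \<le> mult b4 A" using assms by (intro mult_ge_ell) auto
  then show False using mult_b4_less by (simp add: eval_nat_numeral)
qed

lemma ord_b4:
  assumes "H \<ge> 3" "v < n"
  shows "ord b4 v = period3 3 (h v)"
proof (rule period3_states)
  show "A $$ (v, v) \<noteq> b4" if "v < n" "h v \<noteq> 1" for v
    using diagonal_neq[of b4 v] that distinct by auto
  show "ord b4 v = 0" if v: "v < n" "h v < 3" for v
  proof -
    consider "h v = 0" | "h v = 1" | "h v = 2" using v by linarith
    then show ?thesis
    proof cases
      case 1
      then show ?thesis using leaf_ord_val(1)[OF v(1)] distinct by auto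
    next
      case 2
      then show ?thesis using level1(4)[OF v(1)] distinct by auto
    next
      case 3
      then have "val b4 v \<noteq> 0" "ord b4 v \<noteq> -1"
        using level2(2,3)[OF v(1), of b4] sum_b_neq[OF assms(1)] distinct by auto
      then show ?thesis using ord_root_iff[OF v(1), of b4] ord_bounds[OF v(1), of b4] by auto
    qed
  qed
qed (use mult_b assms in auto)

text \<open>The value of the kids at \<open>b4\<close> comes from \<open>level2\<close>; its
  denominator cancels the factor b4 - a2 contributed by v.\<close>

lemma level3:
  assumes v: "v < n" "h v = 3"
  shows "down_weight v = (b4 - a1) * (b3 - b4) * (a2 + b2 - b3 - b4) / (b4 - b2)"
proof -
  have kid: "u < n" "h u = 2" if "u \<in> kids v" for u
    using h_kid[OF that] that v by (auto simp: kids_iff)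
  have H3: "H \<ge> 3" using h_le[OF v(1)] v by simp
  have d: "A $$ (v, v) = a2" using diagonal v by simp
  have ne: "b4 \<notin> {a1, a2, b2}" "b3 \<noteq> b4" using distinct by auto
  have "down_weight v = (b4 - A $$ (v, v)) * ((b4 - a1) * (b4 - b3) * (b4 + b3 - a2 - b2) / ((b4 - a2) * (b4 - b2)))"
    by (rule down_weight_of_root[OF v(1)])
      (use kid level2(2) ne ord_b4[OF H3] v sum_b_neq[OF H3] in \<open>auto simp: period3_def\<close>)
  also have "\<dots> = (b4 - a1) * (b3 - b4) * (a2 + b2 - b3 - b4) / (b4 - b2)"
    unfolding d using ne by (simp add: divide_simps) (simp add: algebra_simps)
  finally show ?thesis .
qed

text \<open>At least a full period above the first zeros, a zero v has kids of order 0 and grandkids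
  that are poles. So each kid has value x minus its diagonal entry, and the entries at v and its
  kids are \<open>a1\<close> and \<open>a2\<close> in some order.\<close>

lemma level_ge4:
  assumes v: "v < n" "h v \<ge> 4"
  shows "down_weight v = (if h v mod 3 = 1 then (b2 - a1) * (b2 - a2)
     else if h v mod 3 = 2 then (b3 - a1) * (b3 - a2) else (b4 - a1) * (b4 - a2))"
proof -
  have H3: "H \<ge> 3" using h_le[OF v(1)] v by simp
  have main: "down_weight v = (x - a1) * (x - a2)"
    if x: "x \<noteq> a1" "x \<noteq> a2" and st: "\<And>u. u < n \<Longrightarrow> ord x u = period3 s (h u)"
      and s: "h v = s + 3 * k" "k > 0" for x s k
  proof -
    define y where "y = (if even (h v) then a2 else a1)"
    have kid: "u < n" "h v = Suc (h u)" if "u \<in> kids v" for u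
      using h_kid[OF that] that by (auto simp: kids_iff)
    obtain j where j: "k = Suc j" using s(2) gr0_implies_Suc by blast
    have kid_val: "ord x u = 0" "val x u = x - y" if u: "u \<in> kids v" for u
    proof -
      have hu: "h u = s + (3 * j + 2)" using kid(2)[OF u] s j by simp
      have "(3 * j + 2) mod 3 = 2" "(3 * j + 1) mod 3 = 1" by presburger+
      then have per: "period3 s (s + (3 * j + 2)) = 0" "period3 s (s + (3 * j + 1)) = -1"
        unfolding period3_def by (simp_all only: diff_add_inverse) simp_all
      have ord_u: "ord x u = 0" using st[OF kid(1)[OF u]] hu per(1) by (simp only:)
      have "ord x w = -1" if w: "w \<in> kids u" for w
      proof -
        have "w < n" "h w = s + (3 * j + 1)" using h_kid[OF w] hu w by (auto simp: kids_iff)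
        then show ?thesis using st per(2) by (simp only:)
      qed
      then have "val x u = x - A $$ (u, u)" using val_eq[OF kid(1)[OF u], of x] ord_u by simp
      moreover have "A $$ (u, u) = y" using diagonal[OF kid(1)[OF u]] kid(2)[OF u] v hu by (auto simp: y_def)
      ultimately show "ord x u = 0" "val x u = x - y" using ord_u by auto
    qed
    have "ord x v = 1" using st[OF v(1)] s by (simp add: period3_def)
    then have "down_weight v = (x - A $$ (v, v)) * (x - y)"
      using kid_val x by (intro down_weight_of_root[OF v(1)]) (auto simp: y_def)
    then show ?thesis using diagonal[OF v(1)] v by (auto simp: y_def)
  qed
  have div: "h v = h v mod 3 + 3 * (h v div 3)" by simp
  consider "h v mod 3 = 1" | "h v mod 3 = 2" | "h v mod 3 = 0" by linarith
  then show ?thesis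
  proof cases
    case 1
    then have "h v = 1 + 3 * (h v div 3)" "h v div 3 > 0" using div v by linarith+
    then show ?thesis using main[of b2 1] ord_b2 distinct 1 by auto
  next
    case 2
    then have "h v = 2 + 3 * (h v div 3)" "h v div 3 > 0" using div v by linarith+
    then show ?thesis using main[of b3 2] ord_b3 distinct 2 by auto
  next
    case 3
    \<comment> \<open>The pattern of \<open>b4\<close> starts at height 3, itself a multiple of 3,
      so one period is split off.\<close>
    then have "h v = 3 + 3 * (h v div 3 - 1)" "h v div 3 - 1 > 0" using div v by linarith+
    then show ?thesis using main[of b4 3] ord_b4[OF H3] distinct 3 by auto
  qed
qed

text \<open>The index is shifted because a_1 belongs to the leaves. For H = 2 the indices end at 3,
  where the fifth parameter does not occur; hence the free \<open>c\<close>.\<close>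

lemma coefficients:
  assumes v: "v < n" and c: "H \<ge> 3 \<Longrightarrow> c = b4"
  shows "A $$ (v, v) = coef_a (a1, a2, b2, b3, c) (Suc (h v))"
    and "h v \<ge> 1 \<Longrightarrow> down_weight v = coef_b (a1, a2, b2, b3, c) (Suc (h v))"
proof -
  show "A $$ (v, v) = coef_a (a1, a2, b2, b3, c) (Suc (h v))"
    using level1(1)[OF v] diagonal[OF v] by (cases "h v = 1") (auto simp: coef_a_def)
  have m3: "Suc k mod 3 = 2 \<longleftrightarrow> k mod 3 = 1" "Suc k mod 3 = 0 \<longleftrightarrow> k mod 3 = 2" for k :: nat
    by presburger+
  assume "h v \<ge> 1"
  then consider "h v = 1" | "h v = 2" | "h v = 3" | "h v \<ge> 4" by linarith
  then show "down_weight v = coef_b (a1, a2, b2, b3, c) (Suc (h v))"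
  proof cases
    case 1
    then show ?thesis using level1(2)[OF v] by (simp add: coef_b_def)
  next
    case 2
    then show ?thesis using level2(1)[OF v] by (simp add: coef_b_def)
  next
    case 3
    then show ?thesis using level3[OF v] c h_le[OF v] by (simp add: coef_b_def)
  next
    case 4
    then show ?thesis using level_ge4[OF v 4] c h_le[OF v] by (simp add: coef_b_def m3)
  qed
qed

lemma coef_b_pos:
  assumes "H \<ge> 3 \<Longrightarrow> c = b4" "2 \<le> i" "i \<le> H + 1"
  shows "coef_b (a1, a2, b2, b3, c) i > 0"
proof -
  obtain v where "v < n" "h v = i - 1" using ex_height[of "i - 1"] assms(3) by fastforce
  then show ?thesis
    using coefficients(2)[of v c] down_weight_pos[of v] assms by simp
qed

end

section \<open>The spectrum\<close>

text \<open>A continued fraction built from the last row upwards: term k is the quotient of the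
  characteristic polynomials of the trailing blocks of sizes k + 1 and k, expanded at x.\<close>

primrec tri_schur :: "(nat \<Rightarrow> real) \<Rightarrow> (nat \<Rightarrow> real) \<Rightarrow> real \<Rightarrow> nat \<Rightarrow> real fls" where
  "tri_schur p q x 0 = fls_X + fls_const (x - p 0)"
| "tri_schur p q x (Suc k) = fls_X + fls_const (x - p (Suc k)) - fls_const (q (Suc k)) / tri_schur p q x k"

text \<open>Stated for a grading \<open>g\<close> so that it serves both the hedge, graded by
  height, and the path, graded by the number of vertices below.\<close>

lemma (in weighted_tree) schur_eq_tri_schur:
  assumes height: "\<And>u v. u \<in> kids v \<Longrightarrow> g v = Suc (g u)" "\<And>v. v < n \<Longrightarrow> g v > 0 \<Longrightarrow> kids v \<noteq> {}"
    and p: "\<And>v. v < n \<Longrightarrow> A $$ (v, v) = p (g v)"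
    and q: "\<And>v. v < n \<Longrightarrow> g v > 0 \<Longrightarrow> (\<Sum>u\<in>kids v. wt v u) = q (g v)"
    and "v < n"
  shows "schur x v = tri_schur p q x (g v)"
  using \<open>v < n\<close>
proof (induction "g v" arbitrary: v)
  case 0
  then have "kids v = {}" using height(1) by fastforce
  then show ?case using 0 p by (simp add: schur_rec flip: \<open>0 = g v\<close>)
next
  case (Suc k)
  have "schur x u = tri_schur p q x k" if "u \<in> kids v" for u
    using Suc.hyps(1)[of u] Suc.hyps(2) height(1)[OF that] that by (simp add: kids_iff)
  then have "(\<Sum>u\<in>kids v. fls_const (wt v u) / schur x u) = (\<Sum>u\<in>kids v. fls_const (wt v u)) / tri_schur p q x k"
    unfolding sum_divide_distrib by (intro sum.cong) auto
  also have "(\<Sum>u\<in>kids v. fls_const (wt v u)) = fls_const (q (Suc k))"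
  proof -
    have "(\<Sum>u\<in>S. fls_const (wt v u)) = fls_const (\<Sum>u\<in>S. wt v u)" for S
      by (induction S rule: infinite_finite_induct) (simp_all add: fls_plus_const)
    then show ?thesis using q[OF Suc.prems] Suc.hyps(2) by simp
  qed
  finally show ?case using p[OF Suc.prems] by (simp add: schur_rec[OF Suc.prems] flip: Suc.hyps(2))
qed

lemma path_children: "children m 0 path_par v = (if Suc v < m then {Suc v} else {})"
  by (auto simp: children_def is_child_def path_par_def)

lemma rooted_path: "m \<ge> 1 \<Longrightarrow> rooted m 0 path_par"
proof
  assume "m \<ge> 1"
  have "(path_par ^^ k) v = v - k" for k v by (induction k) (auto simp: path_par_def)
  then have "\<exists>k. (path_par ^^ k) v = 0" for v by (metis diff_self_eq_0)
  then show "rooted_tree m 0 path_par" using \<open>m \<ge> 1\<close> by (auto simp: rooted_tree_def path_par_def)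
qed

lemma weighted_path:
  assumes "m \<ge> 1" "\<And>i. 2 \<le> i \<Longrightarrow> i \<le> m \<Longrightarrow> coef_b L i > 0"
  shows "weighted_tree m 0 path_par (CL L m)"
proof (intro weighted_tree.intro rooted_path assms(1) weighted_tree_axioms.intro)
  have adj: "adj m 0 path_par i j \<longleftrightarrow> i < m \<and> j < m \<and> (i = Suc j \<or> j = Suc i)" for i j
    by (auto simp: adj_def path_par_def)
  have pos: "coef_b L (m - i) > 0" if "Suc i < m" for i using that by (intro assms(2)) auto
  have nz: "coef_b L (m - i) \<noteq> 0" if "Suc i < m" for i using pos[OF that] by simp
  show "in_R m 0 path_par (CL L m)"
    using pos nz by (auto simp: in_R_def adj CL_def)
qed

lemma expand_at_char_poly_CL:
  assumes "m \<ge> 1" "\<And>i. 2 \<le> i \<Longrightarrow> i \<le> m \<Longrightarrow> coef_b L i > 0"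
  shows "expand_at x (char_poly (CL L m)) =
    (\<Prod>j<m. tri_schur (\<lambda>k. coef_a L (Suc k)) (\<lambda>k. coef_b L (Suc k)) x j)"
proof -
  interpret weighted_tree m 0 path_par "CL L m" by (rule weighted_path[OF assms])
  have "schur x v = tri_schur (\<lambda>k. coef_a L (Suc k)) (\<lambda>k. coef_b L (Suc k)) x (m - Suc v)" if "v < m" for v
    using that
    by (intro schur_eq_tri_schur) (auto simp: path_children CL_def Suc_diff_Suc split: if_splits)
  then show ?thesis
    unfolding expand_at_char_poly by (simp add: prod.nat_diff_reindex)
qed

section \<open>Regrouping the characteristic polynomial by trailing blocks\<close>

context lush_hedge
begin

text \<open>The factor of level j occurs |V_j| times, and |V_j| is the sum of l_i over i > j.
  Exchanging the products collects levels 0 to i - 1, which form the trailing block of size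
  i.\<close>

lemma prod_levels:
  fixes f :: "nat \<Rightarrow> 'a :: comm_semiring_1"
  shows "(\<Prod>v<n. f (h v)) = (\<Prod>i\<in>{1..H + 1}. (\<Prod>j<i. f j) ^ ell n r par i)"
proof -
  have card: "(\<Sum>i | i \<in> {1..H + 1} \<and> j < i. ell n r par i) = card (Vlev n r par j)" for j
  proof -
    have "{i. i \<in> {1..H + 1} \<and> j < i} = {i. 1 \<le> i \<and> i \<le> H + 1 \<and> j < i}" by auto
    then show ?thesis using sum_ell_from[of j] by (simp only: of_nat_eq_iff flip: of_nat_sum)
  qed
  have "(\<Prod>v<n. f (h v)) = (\<Prod>j\<le>H. \<Prod>v\<in>{v\<in>{..<n}. h v = j}. f (h v))"
    by (rule prod.group[symmetric]) (auto simp: h_le)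
  also have "\<dots> = (\<Prod>j\<le>H. f j ^ card (Vlev n r par j))"
    by (intro prod.cong) (auto simp: Vlev_def)
  also have "\<dots> = (\<Prod>j\<le>H. \<Prod>i | i \<in> {1..H + 1} \<and> j < i. f j ^ ell n r par i)"
    by (simp only: card[symmetric] power_sum)
  also have "\<dots> = (\<Prod>i\<in>{1..H + 1}. \<Prod>j | j \<in> {..H} \<and> j < i. f j ^ ell n r par i)"
    by (rule prod.swap_restrict) auto
  also have "\<dots> = (\<Prod>i\<in>{1..H + 1}. (\<Prod>j<i. f j) ^ ell n r par i)"
  proof (rule prod.cong[OF refl])
    fix i assume "i \<in> {1..H + 1}"
    then have "{j. j \<in> {..H} \<and> j < i} = {..<i}" by auto
    then show "(\<Prod>j | j \<in> {..H} \<and> j < i. f j ^ ell n r par i) = (\<Prod>j<i. f j) ^ ell n r par i"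
      by (simp add: prod_power_distrib)
  qed
  finally show ?thesis .
qed

lemma path_to_hedge:
  assumes a: "\<And>v. v < n \<Longrightarrow> A $$ (v, v) = coef_a L (Suc (h v))"
    and b: "\<And>v. v < n \<Longrightarrow> h v \<ge> 1 \<Longrightarrow> down_weight v = coef_b L (Suc (h v))"
  shows "in_PH (CL L (H + 1)) n r par A"
    and "spec A = (\<Sum>i\<in>{1..H + 1}. repeat_mset (ell n r par i) (spec (CL L i)))"
proof -
  have pos: "coef_b L i > 0" if i: "2 \<le> i" "i \<le> H + 1" for i
  proof -
    have "i - 1 \<le> H" using i by linarith
    then obtain v where "v < n" "h v = i - 1" using ex_height by blast
    then show ?thesis using b[of v] down_weight_pos[of v] i by simp
  qed
  interpret P: weighted_tree "H + 1" 0 path_par "CL L (H + 1)"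
    by (rule weighted_path) (use pos in auto)
  have "CL L (H + 1) $$ (H - h v, H - h v) = coef_a L (Suc (h v))" if "v < n" for v
    using h_le[OF that] by (simp add: CL_def Suc_diff_le)
  moreover have "CL L (H + 1) $$ (H - h v, H - h v + 1) * CL L (H + 1) $$ (H - h v + 1, H - h v)
     = coef_b L (Suc (h v))" if "v < n" "h v \<ge> 1" for v
    using h_le[OF that(1)] that(2) by (simp add: CL_def Suc_diff_le)
  moreover have "h v \<ge> 1" if "v < n" "\<not> is_leaf n r par v" for v
    using that leaf_iff_h by (simp add: Suc_le_eq)
  ultimately show "in_PH (CL L (H + 1)) n r par A"
    unfolding in_PH_def Let_def using a b P.in_R in_R by simp

  \<comment> \<open>The point 0 is arbitrary: by \<open>inj_expand_at\<close> an identity of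
    expansions at a single point is an identity of polynomials.\<close>
  let ?T = "tri_schur (\<lambda>k. coef_a L (Suc k)) (\<lambda>k. coef_b L (Suc k)) 0"
  have "expand_at 0 (char_poly A) = (\<Prod>v<n. ?T (h v))"
    unfolding expand_at_char_poly
  proof (intro prod.cong refl schur_eq_tri_schur)
    show "kids v \<noteq> {}" if "v < n" "h v > 0" for v using kids_empty_iff that by simp
  qed (use a b h_kid in \<open>simp_all add: Suc_le_eq\<close>)
  also have "\<dots> = (\<Prod>i\<in>{1..H + 1}. (\<Prod>j<i. ?T j) ^ ell n r par i)"
    by (rule prod_levels)
  also have "\<dots> = (\<Prod>i\<in>{1..H + 1}. expand_at 0 (char_poly (CL L i)) ^ ell n r par i)"
    by (intro prod.cong refl) (use pos in \<open>auto simp: expand_at_char_poly_CL\<close>)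
  also have "\<dots> = expand_at 0 (\<Prod>i\<in>{1..H + 1}. char_poly (CL L i) ^ ell n r par i)"
    by (simp add: expand_at.hom_prod expand_at.hom_power del: prod.cl_ivl_Suc)
  finally have eq: "char_poly A = (\<Prod>i\<in>{1..H + 1}. char_poly (CL L i) ^ ell n r par i)"
    using inj_expand_at by (simp add: inj_eq)
  interpret of_real_poly: map_poly_comm_ring_hom complex_of_real ..
  have car: "CL L i \<in> carrier_mat i i" for i by (simp add: CL_def)
  have nz: "char_poly (map_mat complex_of_real (CL L i)) \<noteq> 0" for i
    using degree_monic_char_poly[of "map_mat complex_of_real (CL L i)" i] car by auto
  have "char_poly (map_mat complex_of_real A) =
      (\<Prod>i\<in>{1..H + 1}. char_poly (map_mat complex_of_real (CL L i)) ^ ell n r par i)"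
    unfolding of_real_hom.char_poly_hom[OF carrier_A] of_real_hom.char_poly_hom[OF car] eq
    by (simp add: of_real_poly.hom_prod of_real_poly.hom_power del: prod.cl_ivl_Suc)
  then show "spec A = (\<Sum>i\<in>{1..H + 1}. repeat_mset (ell n r par i) (spec (CL L i)))"
    using nz by (simp add: spec_def proots_prod proots_power del: prod.cl_ivl_Suc sum.cl_ivl_Suc)
qed

end

section \<open>From positive coefficients to the inequalities of B\<close>

lemma in_B_if_coef_b_pos:
  assumes "distinct [a1, a2, b2, b3, b4]"
    and "\<And>i. i \<in> {2, 3, 4} \<Longrightarrow> coef_b (a1, a2, b2, b3, b4) i > 0"
  shows "in_B (a1, a2, b2, b3, b4)"
proof -
  have "(b2 - a1) * (a1 - a2) > 0" "(b3 - a2) * (b3 - b2) > 0"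
    and c4: "(b4 - a1) * (b3 - b4) * (a2 + b2 - b3 - b4) / (b4 - b2) > 0"
    using assms(2)[of 2] assms(2)[of 3] assms(2)[of 4] by (simp_all add: coef_b_def)
  \<comment> \<open>b_2 > 0 puts \<open>a1\<close> between \<open>a2\<close> and \<open>b2\<close>;
    b_3 > 0 puts \<open>b3\<close> outside the interval between \<open>a2\<close> and
    \<open>b2\<close>. In each of the four combinations the sign of b_4 leaves only positions of
    \<open>b4\<close> listed in \<open>in_B\<close>.\<close>
  then have c2: "a1 < b2 \<and> a2 < a1 \<or> b2 < a1 \<and> a1 < a2"
    and c3: "a2 < b3 \<and> b2 < b3 \<or> b3 < a2 \<and> b3 < b2"
    by (auto simp: zero_less_mult_iff)
  show ?thesis
    using assms(1) c2 c3 c4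
    unfolding in_B_def prod.case zero_less_divide_iff zero_less_mult_iff mult_less_0_iff
      diff_gt_0_iff_gt diff_less_0_iff_less distinct.simps list.set insert_iff
    by (smt (verit))
qed

lemma (in critical_hedge) ex_in_B: "\<exists>c. (H \<ge> 3 \<longrightarrow> c = b4) \<and> in_B (a1, a2, b2, b3, c)"
proof (cases "H \<ge> 3")
  case True
  then have "in_B (a1, a2, b2, b3, b4)"
    using distinct by (intro in_B_if_coef_b_pos coef_b_pos) auto
  then show ?thesis by blast
next
  case False
  have "coef_b (a1, a2, b2, b3, b4) 2 > 0" "coef_b (a1, a2, b2, b3, b4) 3 > 0"
    using height_ge_2 by (auto intro!: coef_b_pos)
  then have c: "a1 < b2 \<and> a2 < a1 \<or> b2 < a1 \<and> a1 < a2"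
    "a2 < b3 \<and> b2 < b3 \<or> b3 < a2 \<and> b3 < b2"
    by (auto simp: coef_b_def zero_less_mult_iff)
  \<comment> \<open>For H = 2 the given \<open>b4\<close> may violate the inequalities. A point
    beyond \<open>b3\<close>, on the side away from \<open>b2\<close>, meets one of the cases
    without a condition on sums in each of the four combinations.\<close>
  have "in_B (a1, a2, b2, b3, if b2 < b3 then b3 + 1 else b3 - 1)"
    using c by (auto simp: in_B_def)
  then show ?thesis using False by blast
qed

theorem mainTheorem15:
  fixes n r :: nat and par :: "nat \<Rightarrow> nat" and A :: "real mat"
    and a1 a2 b2 b3 b4 :: real
  assumes "lush n r par"
    and "hedge_height n r par \<ge> 2"
    and "in_R n r par A"
    and "crit_witness n r par A a1 a2 b2 b3 b4"
  shows "\<exists>L. in_B L \<and>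
           in_PH (CL L (hedge_height n r par + 1)) n r par A \<and>
           spec A = (\<Sum>i\<in>{1..hedge_height n r par + 1}.
                       repeat_mset (ell n r par i) (spec (CL L i))) \<and>
           mult a1 A = (\<Sum>i\<in>{i. 1 \<le> i \<and> i \<le> hedge_height n r par + 1 \<and> i mod 2 = 1}.
                          ell n r par i) \<and>
           mult a2 A = (\<Sum>i\<in>{i. 2 \<le> i \<and> i \<le> hedge_height n r par + 1 \<and> i mod 2 = 0}.
                          ell n r par i)"
proof -
  have tree: "rooted_tree n r par" using assms(1) by (simp add: lush_def is_hedge_def)
  interpret critical_hedge n r par A a1 a2 b2 b3 b4
    by unfold_locales (fact tree assms)+
  obtain c where c: "H \<ge> 3 \<longrightarrow> c = b4" and B: "in_B (a1, a2, b2, b3, c)"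
    using ex_in_B by blast
  have "{i. 1 \<le> i \<and> i \<le> H + 1 \<and> i mod 2 = 1} = {i. 1 \<le> i \<and> i \<le> H + 1 \<and> odd i}"
    by (simp only: odd_iff_mod_2_eq_one)
  then have m1: "mult a1 A = (\<Sum>i\<in>{i. 1 \<le> i \<and> i \<le> H + 1 \<and> i mod 2 = 1}. ell n r par i)"
    using mult_alpha_eq(1) by (simp only: of_nat_eq_iff flip: of_nat_sum)
  have "2 \<le> i \<and> i \<le> H + 1 \<and> i mod 2 = 0 \<longleftrightarrow> 1 \<le> i \<and> i \<le> H + 1 \<and> even i" for i
    by presburger
  then have "{i. 2 \<le> i \<and> i \<le> H + 1 \<and> i mod 2 = 0} = {i. 1 \<le> i \<and> i \<le> H + 1 \<and> even i}"
    by (simp only:)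
  then have m2: "mult a2 A = (\<Sum>i\<in>{i. 2 \<le> i \<and> i \<le> H + 1 \<and> i mod 2 = 0}. ell n r par i)"
    using mult_alpha_eq(2) by (simp only: of_nat_eq_iff flip: of_nat_sum)
  have coeff: "A $$ (v, v) = coef_a (a1, a2, b2, b3, c) (Suc (h v))"
    "h v \<ge> 1 \<Longrightarrow> down_weight v = coef_b (a1, a2, b2, b3, c) (Suc (h v))" if "v < n" for v
    by (rule coefficients[OF that c[rule_format]]; assumption)+
  have "in_PH (CL (a1, a2, b2, b3, c) (H + 1)) n r par A"
    "spec A = (\<Sum>i\<in>{1..H + 1}. repeat_mset (ell n r par i) (spec (CL (a1, a2, b2, b3, c) i)))"
    by (rule path_to_hedge; rule coeff; assumption)+
  then show ?thesis using B m1 m2 by blast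
qed

end
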